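(* For every integer $g\ge1$, $$\sigma(2g+1)\ \ge\ \sigma(2g)\ \ge\ \frac{g+2\lfloor g/3\rfloor+\lfloor g/6\rfloor}{\sqrt{3g^2-g\lfloor g/3\rfloor+g}}.$$ In particular, $$\liminf_{g\to\infty}\sigma(g)\ \ge\ \frac{11}{\sqrt{96}}.$$
   Context: $[n]=\{1,2,\dots,n\}$. For a finite set $S\subseteq\mathbb{Z}$ and $k\in\mathbb{Z}$, let $S\ast S(k)=|\{(s_1,s_2): s_1,s_2\in S,\ s_1+s_2=k\}|$ (ordered pairs), and let $\|S\ast S\|_\infty=\max_{k\in\mathbb{Z}} S\ast S(k)$. For positive integers $g,n$, define $R(g,n)=\max\{|S| : S\subseteq[n],\ \|S\ast S\|_\infty\le g\}$. For $g\ge2$ define $\sigma(g)=\liminf_{n\to\infty}\dfrac{R(g,n)}{\sqrt{\lfloor g/2\rfloor\, n}}$. *)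

theory Defs
  imports Complex_Main "HOL-Library.Extended_Real"
begin

definition rep_count :: "int set \<Rightarrow> int \<Rightarrow> nat" where
  "rep_count S k = card {(s1, s2). s1 \<in> S \<and> s2 \<in> S \<and> s1 + s2 = k}"

definition conv_norm :: "int set \<Rightarrow> nat" where
  "conv_norm S = Max (range (rep_count S))"

definition R :: "nat \<Rightarrow> nat \<Rightarrow> nat" where
  "R g n = Max {card S | S. S \<subseteq> {1..int n} \<and> conv_norm S \<le> g}"

(* The lower limit is taken in the extended reals, a complete lattice, so that it
   exists without a separate boundedness argument. Only g >= 2 is meaningful
   (for g < 2 the denominator is 0). *)
definition sigma :: "nat \<Rightarrow> ereal" where
  "sigma g = liminf (\<lambda>n. ereal (real (R g n) / sqrt (real (g div 2) * real n)))"

text \<open>The maxima above are taken over finite nonempty sets.\<close>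

lemma finite_range_rep_count:
  assumes "finite S"
  shows "finite (range (rep_count S))"
proof -
  have "rep_count S k \<le> card (S \<times> S)" for k
    unfolding rep_count_def using assms by (intro card_mono) auto
  then have "range (rep_count S) \<subseteq> {..card (S \<times> S)}"
    by blast
  then show ?thesis
    using finite_subset by blast
qed

lemma finite_R_set: "finite {card S | S. S \<subseteq> {1..int n} \<and> conv_norm S \<le> g}"
  by (rule finite_subset[of _ "card ` Pow {1..int n}"]) auto

lemma R_set_nonempty: "{card S | S. S \<subseteq> {1..int n} \<and> conv_norm S \<le> g} \<noteq> {}"
proof -
  have "rep_count {} = (\<lambda>_. 0)"
    by (auto simp: rep_count_def)
  then have "conv_norm {} \<le> g"
    by (simp add: conv_norm_def)
  then show ?thesis
    by blast
qed

end

theory Submission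
  imports "HOL-Complex_Analysis.Complex_Analysis" "HOL-Number_Theory.Number_Theory" "HOL-Real_Asymp.Real_Asymp" Defs
begin

text \<open>
  Let \<open>S\<close> be a Sidon set modulo \<open>m\<close> and let \<open>A\<close> be a set of integers in which every integer has at
  most \<open>g\<close> representations. In \<open>{s + m a | s \<in> S, a \<in> A}\<close> a sum determines the unordered pair
  \<open>{s, s'}\<close> and then \<open>a + a'\<close>, so it has at most \<open>2 g\<close> representations. We use Ruzsa's set for
  \<open>S\<close>, with \<open>m = p (p - 1)\<close> and \<open>p - 1\<close> elements, and for \<open>A\<close> the union of three intervals and an
  arithmetic progression of difference 2 inside an interval of length \<open>3 g - \<lfloor>g / 3\<rfloor> + 1\<close>.

  A lower limit over all \<open>n\<close> needs a prime in \<open>[(1 - \<epsilon>) x, x]\<close> for all large \<open>x\<close>. This follows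
  from the argument of Wiener and Ikehara. Since \<open>\<zeta>\<close> has no zero on \<open>Re s = 1\<close>, the series
  \<open>\<Sum> (\<Lambda>(n) - 1) n\<^sup>-\<^sup>s\<close> extends continuously to that line, so by the Riemann--Lebesgue lemma the averages
  of \<open>\<Lambda>(n) / n\<close> and of \<open>1 / n\<close> against a Fejer kernel in \<open>log n\<close> centred at \<open>T\<close> agree in the limit
  \<open>T \<rightarrow> \<infinity>\<close>. For a narrow kernel almost all of the average comes from a short window around \<open>T\<close>,
  which therefore contains a prime.
\<close>

section \<open>The zeta function on the line \<open>Re s = 1\<close>\<close>

text \<open>The exponent a of n^(-a) stays above 1 throughout, where all series converge absolutely.
  For a fixed a > 1 the averages tend to 0 as T grows, so a has to approach 1 after T is chosen, and
  the comparison of the two averages must hold uniformly for a just above 1. The other obstacle is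
  the tail of the kernel, which has to be small also when weighted with \<Lambda>; no bound of
  Chebyshev type is presupposed. Such a bound is drawn from the comparison itself with the fixed
  kernel parameter l = 1. It does not depend on the l used later, so l can then be taken large
  enough to make the tail negligible. Since one prime per window suffices and no asymptotic count is
  wanted, the constants are crude: a main term of at least 1/20 stands against three errors of
  1/100.\<close>

lemma norm_nat_powr: "cmod (of_nat n powr s) = real n powr Re s"
  by (subst norm_powr_real_powr) simp_all

text \<open>Mean value inequality on the segment: at a real point r the derivative of y powr (-s)
  has norm |s| r^(-Re s - 1), which decreases in r because Re s > 0.\<close>

lemma real_powr_diff_bound:
  fixes s x :: complex and m :: real
  assumes m: "m > 0" and x: "x \<in> closed_segment (of_real m) (of_real (m + 1))" and s: "Re s > 0"
  shows "cmod (of_real m powr (-s) - x powr (-s)) \<le> cmod s * m powr (- Re s - 1)"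
proof -
  define S where "S = closed_segment (complex_of_real m) (of_real (m + 1))"
  have S_real: "\<exists>r. y = of_real r \<and> m \<le> r \<and> r \<le> m + 1" if "y \<in> S" for y
    using that unfolding S_def closed_segment_of_real by (auto simp: closed_segment_eq_real_ivl)
  have "cmod (of_real m powr (-s) - x powr (-s)) \<le> (cmod s * m powr (- Re s - 1)) * cmod (of_real m - x)"
  proof (rule field_differentiable_bound[of S])
    show "convex S" by (simp add: S_def)
    show "((\<lambda>y. y powr (-s)) has_field_derivative (-s) * y powr (-s - 1)) (at y within S)" if "y \<in> S" for y
    proof -
      obtain r where r: "y = of_real r" "m \<le> r" using S_real[OF \<open>y \<in> S\<close>] by blast
      have "y \<notin> \<real>\<^sub>\<le>\<^sub>0" using r m by simp
      then show ?thesis by (intro has_field_derivative_at_within[OF has_field_derivative_powr])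
    qed
    show "cmod ((-s) * y powr (-s - 1)) \<le> cmod s * m powr (- Re s - 1)" if "y \<in> S" for y
    proof -
      obtain r where r: "y = of_real r" "m \<le> r" using S_real[OF \<open>y \<in> S\<close>] by blast
      have "cmod (y powr (-s - 1)) = r powr (- Re s - 1)"
        using r m by (simp add: norm_powr_real_powr)
      also have "\<dots> \<le> m powr (- Re s - 1)"
        using r m s by (intro powr_mono2') auto
      finally show ?thesis by (simp add: norm_mult mult_left_mono)
    qed
  qed (use x in \<open>auto simp: S_def\<close>)
  also have "\<dots> \<le> (cmod s * m powr (- Re s - 1)) * 1"
  proof (rule mult_left_mono)
    obtain r where r: "x = of_real r" "m \<le> r" "r \<le> m + 1" using S_real[of x] x unfolding S_def by blast
    have "cmod (of_real m - x) = \<bar>m - r\<bar>" unfolding r(1) of_real_diff[symmetric] by (rule norm_of_real)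
    then show "cmod (of_real m - x) \<le> 1" using r by simp
  qed auto
  finally show ?thesis by simp
qed

text \<open>With m = n + 1 this is s - 1 times the difference between m^(-s) and the integral of
  x^(-s) over [m, m + 1]. Multiplying by s - 1 clears the denominator of that integral, so that s =
  1 is an ordinary point.\<close>

definition zeta_term :: "nat \<Rightarrow> complex \<Rightarrow> complex" where
  "zeta_term n s = (s - 1) * of_nat (Suc n) powr (-s) + of_nat (Suc (Suc n)) powr (1 - s) - of_nat (Suc n) powr (1 - s)"

text \<open>The term is the increment over [m, m + 1] of \<open>f\<close>, whose derivative is (s -
  1) (m^(-s) - x^(-s)). This derivative is itself a difference, so the mean value inequality applies
  twice and gains the factor 1/m that gives convergence for all Re s > 0.\<close>

lemma norm_zeta_term_le:
  assumes s: "Re s > 0"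
  shows "cmod (zeta_term n s) \<le> cmod (s - 1) * cmod s * real (Suc n) powr (- Re s - 1)"
proof -
  define m where "m = real (Suc n)"
  have m: "m > 0" by (simp add: m_def)
  define S where "S = closed_segment (complex_of_real m) (of_real (m + 1))"
  define f where "f = (\<lambda>x. (s - 1) * of_real m powr (-s) * x + x powr (1 - s))"
  have S_real: "\<exists>r. y = of_real r \<and> m \<le> r \<and> r \<le> m + 1" if "y \<in> S" for y
    using that unfolding S_def closed_segment_of_real by (auto simp: closed_segment_eq_real_ivl)
  have "cmod (f (of_real (m + 1)) - f (of_real m)) \<le> (cmod (s - 1) * cmod s * m powr (- Re s - 1)) * cmod (of_real (m + 1) - complex_of_real m)"
  proof (rule field_differentiable_bound[of S])
    show "convex S" by (simp add: S_def)
    show "(f has_field_derivative (s - 1) * (of_real m powr (-s) - y powr (-s))) (at y within S)" if "y \<in> S" for y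
    proof -
      obtain r where r: "y = of_real r" "m \<le> r" using S_real[OF \<open>y \<in> S\<close>] by blast
      have y: "y \<notin> \<real>\<^sub>\<le>\<^sub>0" using r m by simp
      have "(f has_field_derivative (s - 1) * of_real m powr (-s) + (1 - s) * y powr (1 - s - 1)) (at y)"
        unfolding f_def using y by (auto intro!: derivative_eq_intros has_field_derivative_powr)
      then have "(f has_field_derivative (s - 1) * (of_real m powr (-s) - y powr (-s))) (at y)"
        by (simp add: algebra_simps)
      then show ?thesis by (rule has_field_derivative_at_within)
    qed
    show "cmod ((s - 1) * (of_real m powr (-s) - y powr (-s))) \<le> cmod (s - 1) * cmod s * m powr (- Re s - 1)" if "y \<in> S" for y
      using real_powr_diff_bound[OF m _ s, of y] that by (simp add: norm_mult S_def mult.assoc mult_left_mono)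
  qed (auto simp: S_def)
  moreover have "f (of_real (m + 1)) - f (of_real m) = zeta_term n s"
    by (simp add: f_def zeta_term_def m_def algebra_simps)
  ultimately show ?thesis by (simp add: m_def)
qed

text \<open>\<open>zeta_pole s\<close> is \<open>(s - 1) \<zeta>(s)\<close>, continued to the half-plane \<open>Re s > 0\<close>.\<close>

definition zeta_pole :: "complex \<Rightarrow> complex" where
  "zeta_pole s = 1 + (\<Sum>n. zeta_term n s)"

lemma summable_Suc_powr:
  assumes "a < -1"
  shows "summable (\<lambda>n. real (Suc n) powr a)"
  using assms summable_Suc_iff[of "\<lambda>n. real n powr a"] by (simp add: summable_real_powr_iff)

lemma zeta_term_sums: 
  assumes "Re s > 0" shows "(\<lambda>n. zeta_term n s) sums (zeta_pole s - 1)"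
proof -
  have "summable (\<lambda>n. zeta_term n s)"
  proof (rule summable_comparison_test')
    show "summable (\<lambda>n. cmod (s - 1) * cmod s * real (Suc n) powr (- Re s - 1))"
      using assms by (intro summable_mult summable_Suc_powr) auto
    show "norm (zeta_term n s) \<le> cmod (s - 1) * cmod s * real (Suc n) powr (- Re s - 1)" for n
      using norm_zeta_term_le[OF assms] .
  qed
  then show ?thesis by (simp add: zeta_pole_def summable_sums)
qed

lemma zeta_pole_1 [simp]: "zeta_pole 1 = 1"
  by (simp add: zeta_pole_def zeta_term_def del: of_nat_Suc)

lemma open_Re_gt: "open {s. Re s > a}"
  by (simp add: open_halfspace_Re_gt)

lemma zeta_pole_holomorphic: "zeta_pole holomorphic_on {s. Re s > 0}"
proof -
  have "\<exists>g g'. \<forall>x\<in>{s. Re s > 0}. ((\<lambda>n. zeta_term n x) sums g x) \<and> ((\<lambda>n. deriv (zeta_term n) x) sums g' x) \<and> (g has_field_derivative g' x) (at x)"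
  proof (rule series_and_derivative_comparison_local)
    show "open {s. Re s > 0}" by (rule open_Re_gt)
    show "(zeta_term n has_field_derivative deriv (zeta_term n) x) (at x)" for n x
    proof -
      have "zeta_term n holomorphic_on UNIV"
        unfolding zeta_term_def by (intro holomorphic_intros)
      then have "zeta_term n field_differentiable at x"
        by (simp add: holomorphic_on_imp_differentiable_at)
      then show ?thesis by (simp add: DERIV_deriv_iff_field_differentiable)
    qed
    show "\<exists>d h. 0 < d \<and> summable h \<and> (\<forall>\<^sub>F n in sequentially. \<forall>y\<in>ball x d \<inter> {s. Re s > 0}. norm (zeta_term n y) \<le> h n)"
      if "x \<in> {s. Re s > 0}" for x
    proof (intro exI conjI always_eventually allI ballI)
      \<comment> \<open>Half the distance to the imaginary axis: then Re y \<ge> d on the whole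
        ball, and one convergent majorant serves all its points.\<close>
      define d where "d = Re x / 2"
      define M where "M = cmod x + d + 1"
      show "0 < d" using that by (simp add: d_def)
      show "summable (\<lambda>n. M * M * real (Suc n) powr (- d - 1))"
        using \<open>0 < d\<close> by (intro summable_mult summable_Suc_powr) auto
      fix n y assume y: "y \<in> ball x d \<inter> {s. Re s > 0}"
      have xy: "cmod (x - y) < d" using y by (simp add: dist_norm)
      have Re: "Re y \<ge> d" using xy abs_Re_le_cmod[of "x - y"] by (simp add: d_def)
      have M1: "cmod y \<le> M" using norm_triangle_ineq2[of y x] xy by (simp add: M_def norm_minus_commute)
      have M2: "cmod (y - 1) \<le> M" using norm_triangle_ineq4[of y 1] norm_triangle_ineq2[of y x] xy by (simp add: M_def norm_minus_commute)
      have "norm (zeta_term n y) \<le> cmod (y - 1) * cmod y * real (Suc n) powr (- Re y - 1)"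
        using norm_zeta_term_le y by blast
      also have "\<dots> \<le> M * M * real (Suc n) powr (- d - 1)"
        using M1 M2 Re \<open>0 < d\<close> by (intro mult_mono powr_mono) (auto intro: order_trans[OF norm_ge_zero])
      finally show "norm (zeta_term n y) \<le> M * M * real (Suc n) powr (- d - 1)" .
    qed
  qed
  then obtain g g' where g: "\<And>x. Re x > 0 \<Longrightarrow> (\<lambda>n. zeta_term n x) sums g x" "\<And>x. Re x > 0 \<Longrightarrow> (g has_field_derivative g' x) (at x)"
    by auto
  have "(\<lambda>s. 1 + g s) holomorphic_on {s. Re s > 0}"
    using g(2) by (intro holomorphic_intros) (auto simp: holomorphic_on_open[OF open_Re_gt])
  then show ?thesis
    by (rule holomorphic_transform) (use g(1) in \<open>auto simp: zeta_pole_def sums_iff\<close>)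
qed

section \<open>Dirichlet series of zeta and of the von Mangoldt function\<close>

definition zeta :: "complex \<Rightarrow> complex" where
  "zeta s = (\<Sum>n. of_nat n powr (-s))"

lemma zeta_sums:
  assumes "Re s > 1" shows "(\<lambda>n. of_nat n powr (-s)) sums zeta s"
proof -
  have "summable (\<lambda>n. cmod (of_nat n powr (-s)))"
    unfolding norm_nat_powr summable_real_powr_iff using assms by simp
  then show ?thesis
    unfolding zeta_def by (rule summable_sums[OF summable_norm_cancel])
qed

lemma zeta_pole_eq:
  assumes "Re s > 1" shows "zeta_pole s = (s - 1) * zeta s"
proof -
  \<comment> \<open>The summand n = 0 is 0 because \<open>0 powr z\<close> is 0, so the sum on the
    right runs over 1, ..., N; the powers with exponent 1 - s telescope.\<close>
  have 1: "(\<Sum>n<N. zeta_term n s) = (s - 1) * (\<Sum>n<Suc N. of_nat n powr (-s)) + of_nat (Suc N) powr (1 - s) - 1" for N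
    by (induction N) (auto simp: zeta_term_def algebra_simps)
  have "(\<lambda>N. of_nat (Suc N) powr (1 - s)) \<longlonglongrightarrow> 0"
  proof (rule tendsto_norm_zero_cancel)
    have "(\<lambda>N. real (Suc N) powr (1 - Re s)) \<longlonglongrightarrow> 0"
      using assms by real_asymp
    then show "(\<lambda>N. cmod (of_nat (Suc N) powr (1 - s))) \<longlonglongrightarrow> 0"
      unfolding norm_nat_powr by simp
  qed
  moreover have "(\<lambda>N. \<Sum>n<Suc N. of_nat n powr (-s)) \<longlonglongrightarrow> zeta s"
    using zeta_sums[OF assms] unfolding sums_def by (rule LIMSEQ_Suc)
  ultimately have "(\<lambda>N. (s - 1) * (\<Sum>n<Suc N. of_nat n powr (-s)) + of_nat (Suc N) powr (1 - s) - 1) \<longlonglongrightarrow> (s - 1) * zeta s + 0 - 1"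
    by (intro tendsto_intros)
  then have "(\<lambda>n. zeta_term n s) sums ((s - 1) * zeta s + 0 - 1)"
    unfolding sums_def 1 .
  moreover have "(\<lambda>n. zeta_term n s) sums (zeta_pole s - 1)"
    using assms by (intro zeta_term_sums) auto
  ultimately have "(s - 1) * zeta s + 0 - 1 = zeta_pole s - 1"
    by (rule sums_unique2)
  then show ?thesis by simp
qed

text \<open>The exponent (a - 1) / 2 is the midpoint of a and -1: the comparison series still
  converges, and the gap to a absorbs the logarithm.\<close>

lemma summable_ln_powr:
  assumes "a < -1"
  shows "summable (\<lambda>n. ln (real n) * real n powr a)"
proof (rule summable_comparison_test_bigo)
  show "summable (\<lambda>n. norm (real n powr ((a - 1) / 2)))"
    using assms by (simp add: summable_real_powr_iff)
  show "(\<lambda>n. ln (real n) * real n powr a) \<in> O(\<lambda>n. real n powr ((a - 1) / 2))"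
    using assms by real_asymp
qed

lemma zeta_has_field_derivative:
  assumes "Re s > 1"
  obtains D where "(zeta has_field_derivative D) (at s)"
    and "(\<lambda>n. - Ln (of_nat n) * of_nat n powr (-s)) sums D"
proof -
  have "\<exists>g g'. \<forall>x\<in>{s. Re s > 1}. ((\<lambda>n. of_nat n powr (-x)) sums g x) \<and> 
      ((\<lambda>n. - Ln (of_nat n) * of_nat n powr (-x)) sums g' x) \<and> (g has_field_derivative g' x) (at x)"
  proof (rule series_and_derivative_comparison_local)
    show "open {s. Re s > 1}" by (rule open_Re_gt)
    show "((\<lambda>x. of_nat n powr (-x)) has_field_derivative - Ln (of_nat n) * of_nat n powr (-x)) (at x)" for n x
    proof (cases "n = 0")
      case False
      then have "((\<lambda>x. of_nat n powr (-x)) has_field_derivative (Ln (of_nat n) * of_nat n powr (-x)) * (-1)) (at x)"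
        by (intro DERIV_chain2[OF has_field_derivative_powr_right] derivative_eq_intros) auto
      then show ?thesis by simp
    qed auto
    show "\<exists>d h. 0 < d \<and> summable h \<and> (\<forall>\<^sub>F n in sequentially. \<forall>y\<in>ball x d \<inter> {s. Re s > 1}. norm (of_nat n powr (-y)) \<le> h n)"
      if "x \<in> {s. Re s > 1}" for x
    proof (intro exI conjI eventually_mono[OF eventually_gt_at_top[of 0]] ballI)
      define d where "d = (Re x - 1) / 2"
      show "0 < d" using that by (simp add: d_def)
      show "summable (\<lambda>n. real n powr (- d - 1))"
        using \<open>0 < d\<close> by (simp add: summable_real_powr_iff)
      fix n :: nat and y assume n: "n > 0" and y: "y \<in> ball x d \<inter> {s. Re s > 1}"
      have xy: "cmod (x - y) < d" using y by (simp add: dist_norm)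
      have Re: "Re y \<ge> d + 1" using xy abs_Re_le_cmod[of "x - y"] by (simp add: d_def field_simps)
      show "norm (of_nat n powr (-y)) \<le> real n powr (- d - 1)"
        unfolding norm_nat_powr using n Re by (intro powr_mono) auto
    qed
  qed
  then obtain g g' where g: "\<And>x. Re x > 1 \<Longrightarrow> (\<lambda>n. of_nat n powr (-x)) sums g x"
      "\<And>x. Re x > 1 \<Longrightarrow> (\<lambda>n. - Ln (of_nat n) * of_nat n powr (-x)) sums g' x"
      "\<And>x. Re x > 1 \<Longrightarrow> (g has_field_derivative g' x) (at x)"
    by auto
  have "(zeta has_field_derivative g' s) (at s)"
  proof (rule has_field_derivative_transform_within_open)
    show "(g has_field_derivative g' s) (at s)" using g(3) assms by simp
    show "open {s. Re s > 1}" by (rule open_Re_gt)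
    show "g x = zeta x" if "x \<in> {s. Re s > 1}" for x
      using g(1) that by (auto simp: zeta_def sums_iff)
  qed (use assms in auto)
  then show ?thesis using that g(2) assms by blast
qed

text \<open>The sum of \<Lambda> over the divisors of n is ln n, and its terms are
  nonnegative.\<close>

lemma mangoldt_le_ln: 
  assumes "n > 0"
  shows "mangoldt n \<le> ln (real n)"
proof -
  have "(mangoldt n :: real) = (\<Sum>d\<in>{n}. mangoldt d)" by simp
  also have "\<dots> \<le> (\<Sum>d | d dvd n. mangoldt d)"
    using assms by (intro sum_mono2) (auto simp: mangoldt_nonneg)
  also have "\<dots> = ln (real n)"
    using mangoldt_sum[of n, where ?'a = real] assms by simp
  finally show ?thesis .
qed

lemma mangoldt_le_ln': "mangoldt n \<le> ln (real n)"
  using mangoldt_le_ln[of n] by (cases "n = 0") auto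

lemma summable_mangoldt:
  assumes "a < -1"
  shows "summable (\<lambda>n. mangoldt n * real n powr a)"
proof (rule summable_comparison_test'[OF summable_ln_powr[OF assms]])
  show "norm (mangoldt n * real n powr a) \<le> ln (real n) * real n powr a" for n
    by (simp add: abs_mult mult_right_mono mangoldt_le_ln')
qed

definition mangoldt_series :: "complex \<Rightarrow> complex" where
  "mangoldt_series s = (\<Sum>n. mangoldt n * of_nat n powr (-s))"

lemma summable_norm_mangoldt:
  assumes "Re s > 1" shows "summable (\<lambda>n. cmod (mangoldt n * of_nat n powr (-s)))"
  using summable_mangoldt[of "- Re s"] assms by (simp add: norm_mult norm_nat_powr)

lemma mangoldt_series_sums:
  assumes "Re s > 1" shows "(\<lambda>n. mangoldt n * of_nat n powr (-s)) sums mangoldt_series s"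
  unfolding mangoldt_series_def
  using summable_norm_mangoldt[OF assms] by (rule summable_sums[OF summable_norm_cancel])

text \<open>Prepares the Dirichlet product: a positive number has finitely many divisors, while
  every number divides 0.\<close>

lemma has_sum_nat_pos:
  fixes f :: "nat \<Rightarrow> complex"
  assumes "f sums S" "summable (\<lambda>n. cmod (f n))" "f 0 = 0"
  shows "(f has_sum S) {0<..}"
proof -
  have "(f has_sum S) UNIV"
    using assms by (intro norm_summable_imp_has_sum)
  also have "?this \<longleftrightarrow> ?thesis"
    using assms(3) by (intro has_sum_cong_neutral) auto
  finally show ?thesis .
qed

lemma nat_powr_mult: "(of_nat (m * n) :: complex) powr s = of_nat m powr s * of_nat n powr s"
proof (cases "m = 0 \<or> n = 0")
  case False
  then have "(complex_of_real (real m) * complex_of_real (real n)) powr s = complex_of_real (real m) powr s * complex_of_real (real n) powr s"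
    by (intro powr_times_real) auto
  then show ?thesis by simp
qed auto

text \<open>The Dirichlet convolution of \<Lambda> with 1 is the logarithm: the absolutely
  convergent double series over (d, m) is regrouped along n = d m.\<close>

lemma mangoldt_series_mult_zeta:
  assumes "Re s > 1"
  shows "(\<lambda>n. Ln (of_nat n) * of_nat n powr (-s)) sums (mangoldt_series s * zeta s)"
proof -
  define f where "f = (\<lambda>(d, m). (mangoldt d * of_nat d powr (-s)) * (of_nat m powr (-s)) :: complex)"
  have sm: "((\<lambda>n. mangoldt n * of_nat n powr (-s)) has_sum mangoldt_series s) {0<..}"
    using mangoldt_series_sums[OF assms] summable_norm_mangoldt[OF assms] by (intro has_sum_nat_pos) auto
  have snz: "summable (\<lambda>n. cmod (of_nat n powr (-s)))"
    unfolding norm_nat_powr summable_real_powr_iff using assms by simp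
  have sz: "((\<lambda>n. of_nat n powr (-s)) has_sum zeta s) {0<..}"
    using zeta_sums[OF assms] snz by (intro has_sum_nat_pos) auto
  have am: "(\<lambda>n. cmod (mangoldt n * of_nat n powr (-s))) summable_on {0<..}"
    by (rule summable_on_subset_banach[of _ UNIV])
       (use summable_norm_mangoldt[OF assms] in \<open>auto intro!: norm_summable_imp_summable_on\<close>)
  have az: "(\<lambda>n. cmod (of_nat n powr (-s))) summable_on {0<..}"
    by (rule summable_on_subset_banach[of _ UNIV]) (use snz in \<open>auto intro!: norm_summable_imp_summable_on\<close>)
  have "(\<lambda>x. cmod (f x)) summable_on ({0<..} \<times> {0<..})"
  proof (rule summable_on_SigmaI)
    show "((\<lambda>y. cmod (f (x, y))) has_sum cmod (mangoldt x * of_nat x powr (-s)) * infsum (\<lambda>n. cmod (of_nat n powr (-s))) {0<..}) {0<..}" for x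
      using has_sum_cmult_right[OF has_sum_infsum[OF az]] by (simp add: f_def norm_mult)
    show "(\<lambda>x. cmod (mangoldt x * of_nat x powr (-s)) * infsum (\<lambda>n. cmod (of_nat n powr (-s))) {0<..}) summable_on {0<..}"
      using am by (rule summable_on_cmult_left)
  qed auto
  then have "f summable_on ({0<..} \<times> {0<..})"
    by (rule abs_summable_summable)
  then have "(f has_sum (mangoldt_series s * zeta s)) ({0<..} \<times> {0<..})"
  proof (rule has_sum_SigmaI[rotated 2])
    show "((\<lambda>y. f (x, y)) has_sum (mangoldt x * of_nat x powr (-s)) * zeta s) {0<..}" for x
      unfolding f_def prod.case by (rule has_sum_cmult_right[OF sz])
    show "((\<lambda>x. (mangoldt x * of_nat x powr (-s)) * zeta s) has_sum mangoldt_series s * zeta s) {0<..}"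
      by (rule has_sum_cmult_left[OF sm])
  qed
  also have "?this \<longleftrightarrow> ((\<lambda>(n, d). mangoldt d * of_nat n powr (-s)) has_sum (mangoldt_series s * zeta s)) (SIGMA n:{0<..}. {d. d dvd n})"
  proof (rule has_sum_reindex_bij_witness[where i = "\<lambda>(n, d). (d, n div d)" and j = "\<lambda>(d, m). (d * m, d)"])
  qed (auto simp: f_def nat_powr_mult[symmetric] mult.assoc div_greater_zero_iff dvd_imp_le simp del: of_nat_mult intro: dvd_pos_nat)
  finally have S: "((\<lambda>(n, d). mangoldt d * of_nat n powr (-s)) has_sum (mangoldt_series s * zeta s)) (SIGMA n:{0<..}. {d. d dvd n})" .
  have "((\<lambda>n. Ln (of_nat n) * of_nat n powr (-s)) has_sum (mangoldt_series s * zeta s)) {0<..}"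
  proof (rule has_sum_SigmaD[OF S])
    fix n :: nat assume n: "n \<in> {0<..}"
    have "(\<Sum>d | d dvd n. mangoldt d) = Ln (of_nat n :: complex)"
      using mangoldt_sum[of n, where ?'a = complex] n by (simp add: Ln_of_nat)
    then show "((\<lambda>y. case (n, y) of (n, d) \<Rightarrow> mangoldt d * of_nat n powr (-s)) has_sum Ln (of_nat n) * of_nat n powr (-s)) {d. d dvd n}"
      using n by (intro has_sum_finiteI) (auto simp: sum_distrib_right[symmetric])
  qed
  also have "?this \<longleftrightarrow> ((\<lambda>n. Ln (of_nat n) * of_nat n powr (-s)) has_sum (mangoldt_series s * zeta s)) UNIV"
    by (intro has_sum_cong_neutral) auto
  finally show ?thesis by (rule has_sum_imp_sums)
qed

lemma zeta_deriv:
  assumes "Re s > 1"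
  shows "(zeta has_field_derivative - (mangoldt_series s * zeta s)) (at s)"
proof -
  obtain D where D: "(zeta has_field_derivative D) (at s)" "(\<lambda>n. - Ln (of_nat n) * of_nat n powr (-s)) sums D"
    using zeta_has_field_derivative[OF assms] .
  have "(\<lambda>n. - Ln (of_nat n) * of_nat n powr (-s)) sums (- (mangoldt_series s * zeta s))"
    using sums_minus[OF mangoldt_series_mult_zeta[OF assms]] by simp
  with D show ?thesis using sums_unique2 by blast
qed

section \<open>Non-vanishing on Re s = 1\<close>

lemma Re_nat_powr:
  assumes "n > 0"
  shows "Re (of_nat n powr (- (of_real a + \<i> * of_real t))) = real n powr (-a) * cos (t * ln (real n))"
proof -
  have "of_nat n powr (- (of_real a + \<i> * of_real t)) = exp (complex_of_real (- a * ln (real n)) + \<i> * complex_of_real (- t * ln (real n)))"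
    using assms by (simp add: powr_def Ln_of_nat algebra_simps)
  also have "Re \<dots> = exp (- a * ln (real n)) * cos (- t * ln (real n))"
    by (simp add: Re_exp)
  finally show ?thesis using assms by (simp add: powr_def)
qed

text \<open>The inequality 3 + 4 cos x + cos 2x = 2 (1 + cos x)^2 \<ge> 0, used in every term with x
  = t ln n.\<close>

lemma mangoldt_series_341:
  assumes "a > 1"
  shows "3 * Re (mangoldt_series (of_real a)) + 4 * Re (mangoldt_series (of_real a + \<i> * of_real t))
    + Re (mangoldt_series (of_real a + \<i> * of_real (2 * t))) \<ge> 0"
proof -
  have S: "(\<lambda>n. mangoldt n * (real n powr (-a) * cos (u * ln (real n)))) sums Re (mangoldt_series (of_real a + \<i> * of_real u))" for u
  proof -
    have "(\<lambda>n. Re (mangoldt n * of_nat n powr (- (of_real a + \<i> * of_real u)))) sums Re (mangoldt_series (of_real a + \<i> * of_real u))"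
      using assms by (intro sums_Re mangoldt_series_sums) auto
    moreover have "Re (mangoldt n * of_nat n powr (- (of_real a + \<i> * of_real u))) = mangoldt n * (real n powr (-a) * cos (u * ln (real n)))" for n
    proof (cases "n = 0")
      case False
      have "Re (of_real (mangoldt n) * of_nat n powr (- (of_real a + \<i> * of_real u))) = mangoldt n * (real n powr (-a) * cos (u * ln (real n)))"
        using Re_nat_powr[of n a u] False by (simp del: of_real_mangoldt)
      then show ?thesis by simp
    qed auto
    ultimately show ?thesis by (simp only:)
  qed
  have S3: "(\<lambda>n. 3 * (mangoldt n * (real n powr (-a) * cos (0 * ln (real n)))) + 4 * (mangoldt n * (real n powr (-a) * cos (t * ln (real n))))
     + mangoldt n * (real n powr (-a) * cos (2 * t * ln (real n)))) sums
    (3 * Re (mangoldt_series (of_real a + \<i> * of_real 0)) + 4 * Re (mangoldt_series (of_real a + \<i> * of_real t))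
    + Re (mangoldt_series (of_real a + \<i> * of_real (2 * t))))"
    by (intro sums_add sums_mult S)
  have nonneg: "3 * (mangoldt n * (real n powr (-a) * cos (0 * ln (real n)))) + 4 * (mangoldt n * (real n powr (-a) * cos (t * ln (real n))))
     + mangoldt n * (real n powr (-a) * cos (2 * t * ln (real n))) \<ge> 0" for n
  proof -
    define c where "c = cos (t * ln (real n))"
    have C: "cos (2 * t * ln (real n)) = 2 * c\<^sup>2 - 1"
      using cos_double_cos[of "t * ln (real n)"] by (simp add: c_def mult.assoc)
    have "3 * (mangoldt n * (real n powr (-a) * cos (0 * ln (real n)))) + 4 * (mangoldt n * (real n powr (-a) * cos (t * ln (real n))))
     + mangoldt n * (real n powr (-a) * cos (2 * t * ln (real n))) = mangoldt n * real n powr (-a) * (2 * (1 + c)\<^sup>2)"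
      unfolding C unfolding c_def[symmetric] by (simp add: algebra_simps power2_eq_square)
    then show ?thesis by (simp add: mangoldt_nonneg)
  qed
  have "0 \<le> 3 * Re (mangoldt_series (of_real a + \<i> * of_real 0)) + 4 * Re (mangoldt_series (of_real a + \<i> * of_real t))
    + Re (mangoldt_series (of_real a + \<i> * of_real (2 * t)))"
    by (rule sums_le[OF nonneg sums_zero S3])
  then show ?thesis by simp
qed

lemma zeta_pole_nonconst: "\<exists>w\<in>{s. Re s > 0}. zeta_pole w \<noteq> 0"
  by (rule bexI[of _ 1]) auto

lemma zeta_pole_DERIV:
  assumes "Re s > 1"
  shows "(zeta_pole has_field_derivative (zeta s - (s - 1) * (mangoldt_series s * zeta s))) (at s)"
proof (rule has_field_derivative_transform_within_open)
  show "((\<lambda>s. (s - 1) * zeta s) has_field_derivative (zeta s - (s - 1) * (mangoldt_series s * zeta s))) (at s)"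
    using assms by (auto intro!: derivative_eq_intros zeta_deriv)
  show "open {s. Re s > 1}" by (rule open_Re_gt)
qed (use assms zeta_pole_eq in auto)

text \<open>On Re s > 1 the series equals 1 / (s - 1) - P' / P with P = \<open>zeta_pole\<close>.
  Its residue at z is therefore 1 or 0 from the first summand, minus the order k of the zero of P at
  z. Approaching z along z + e with e > 0 reads off this residue while staying where the Dirichlet
  series converges.\<close>

lemma mangoldt_series_limit:
  assumes z: "Re z \<ge> 1"
  obtains k :: nat where "k = 0 \<longleftrightarrow> zeta_pole z \<noteq> 0"
    "((\<lambda>e. of_real e * mangoldt_series (z + of_real e)) \<longlongrightarrow> of_real ((if z = 1 then 1 else 0) - real k)) (at_right 0)"
proof -
  define k where "k = nat (zorder zeta_pole z)"
  define g where "g = zor_poly zeta_pole z"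
  have conn: "connected {s. Re s > 0}"
    by (rule convex_connected[OF convex_halfspace_Re_gt])
  have z0: "z \<in> {s. Re s > 0}" using z by simp
  have order: "(if zeta_pole z = 0 then 0 < zorder zeta_pole z else zorder zeta_pole z = 0) \<and>
    (\<exists>r>0. cball z r \<subseteq> {s. Re s > 0} \<and> g holomorphic_on cball z r \<and>
      (\<forall>w\<in>cball z r. zeta_pole w = g w * (w - z) ^ k \<and> g w \<noteq> 0))"
    unfolding k_def g_def
    by (rule zorder_exist_zero[OF zeta_pole_holomorphic open_Re_gt conn z0 zeta_pole_nonconst])
  then have k0: "k = 0 \<longleftrightarrow> zeta_pole z \<noteq> 0"
    by (auto simp: k_def split: if_splits)
  from order obtain r where r: "r > 0" "cball z r \<subseteq> {s. Re s > 0}" "g holomorphic_on cball z r"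
     and gr: "\<And>w. w \<in> cball z r \<Longrightarrow> zeta_pole w = g w * (w - z) ^ k \<and> g w \<noteq> 0"
    by blast
  have gh: "g holomorphic_on ball z r"
    using r(3) by (rule holomorphic_on_subset) auto
  have eq: "of_real e * mangoldt_series (z + of_real e) = of_real e / (z - 1 + of_real e) - of_real e * (deriv g (z + of_real e) / g (z + of_real e)) - of_nat k"
    if e: "0 < e" "e < r" for e :: real
  proof -
    define s where "s = z + of_real e"
    have s: "s \<in> ball z r" "Re s > 1" "s - z = of_real e" using e z by (auto simp: s_def dist_norm)
    have s1: "s - 1 \<noteq> 0" using s(2) by auto
    have gs: "g s \<noteq> 0" "zeta_pole s = g s * (s - z) ^ k" using gr[of s] s by auto
    have "(zeta_pole has_field_derivative (deriv g s * (s - z) ^ k + g s * (of_nat k * (s - z) ^ (k - 1)))) (at s)"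
    proof (rule has_field_derivative_transform_within_open)
      have "(g has_field_derivative deriv g s) (at s)"
        using gh s(1) by (intro holomorphic_derivI[of g "ball z r"]) auto
      then show "((\<lambda>s. g s * (s - z) ^ k) has_field_derivative (deriv g s * (s - z) ^ k + g s * (of_nat k * (s - z) ^ (k - 1)))) (at s)"
        by (auto intro!: derivative_eq_intros)
      show "g w * (w - z) ^ k = zeta_pole w" if "w \<in> ball z r" for w
        using gr[of w] that by auto
    qed (use s in auto)
    then have D: "deriv g s * (s - z) ^ k + g s * (of_nat k * (s - z) ^ (k - 1)) = zeta s - (s - 1) * (mangoldt_series s * zeta s)"
      using DERIV_unique zeta_pole_DERIV[OF s(2)] by blast
    define E where "E = complex_of_real e"
    have E: "E \<noteq> 0" "s - z = E" using e s by (auto simp: E_def)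
    have P: "(s - 1) * zeta s = g s * E ^ k" using gs(2) zeta_pole_eq[OF s(2)] E by simp
    have eq1: "(s - 1) * E * (deriv g s * E ^ k + g s * (of_nat k * E ^ (k - 1))) = E * ((s - 1) * zeta s) - E * (s - 1) * mangoldt_series s * ((s - 1) * zeta s)"
      unfolding D[unfolded E(2)] by (simp add: algebra_simps)
    have eq2: "(s - 1) * E * (deriv g s * E ^ k + g s * (of_nat k * E ^ (k - 1))) = (s - 1) * (E * deriv g s + of_nat k * g s) * E ^ k"
    proof -
      \<comment> \<open>Multiplication by \<open>E\<close> removes the truncated exponent
        \<open>k - 1\<close>, so the rest of the computation does not distinguish k = 0.\<close>
      have h: "E * (of_nat k * E ^ (k - 1)) = of_nat k * E ^ k"
        by (cases k) auto
      have "(s - 1) * E * (deriv g s * E ^ k + g s * (of_nat k * E ^ (k - 1))) = (s - 1) * (E * deriv g s * E ^ k + g s * (E * (of_nat k * E ^ (k - 1))))"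
        by (simp only: algebra_simps)
      then show ?thesis unfolding h by (simp only: algebra_simps)
    qed
    have "(s - 1) * (E * deriv g s + of_nat k * g s) * E ^ k = (E * g s - E * (s - 1) * mangoldt_series s * g s) * E ^ k"
      unfolding eq2[symmetric] eq1 P by (simp only: algebra_simps)
    then have *: "(s - 1) * (E * deriv g s + of_nat k * g s) = E * g s - E * (s - 1) * mangoldt_series s * g s"
      using E by simp
    have "E * mangoldt_series s = E / (s - 1) - E * (deriv g s / g s) - of_nat k"
    proof -
      have e1: "(E / (s - 1)) * ((s - 1) * g s) = E * g s" "(E * (deriv g s / g s)) * ((s - 1) * g s) = (s - 1) * (E * deriv g s)"
        using s1 gs(1) by simp_all
      have "(E / (s - 1) - E * (deriv g s / g s) - of_nat k) * ((s - 1) * g s) = E * g s - (s - 1) * (E * deriv g s + of_nat k * g s)"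
        unfolding left_diff_distrib[of _ _ "(s - 1) * g s"] e1 by (simp add: algebra_simps)
      also have "\<dots> = (E * mangoldt_series s) * ((s - 1) * g s)"
        unfolding * by simp
      finally have "(E * mangoldt_series s) * ((s - 1) * g s) = (E / (s - 1) - E * (deriv g s / g s) - of_nat k) * ((s - 1) * g s)" ..
      then show ?thesis using s1 gs(1) by simp
    qed
    then show ?thesis by (simp add: E_def s_def algebra_simps)
  qed
  have tz: "((\<lambda>e. z + of_real e) \<longlongrightarrow> z) (at_right 0)"
    by (auto intro!: tendsto_eq_intros)
  have "continuous_on (ball z r) (deriv g)" "continuous_on (ball z r) g"
    using gh by (auto intro!: holomorphic_on_imp_continuous_on holomorphic_deriv)
  then have "isCont (deriv g) z" "isCont g z"
    using r(1) by (auto simp: continuous_on_eq_continuous_at)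
  then have tg: "((\<lambda>e. deriv g (z + of_real e)) \<longlongrightarrow> deriv g z) (at_right 0)" "((\<lambda>e. g (z + of_real e)) \<longlongrightarrow> g z) (at_right 0)"
    using tz by (auto intro: isCont_tendsto_compose)
  have gz: "g z \<noteq> 0" using gr[of z] r by auto
  have t1: "((\<lambda>e. of_real e / (z - 1 + of_real e)) \<longlongrightarrow> (if z = 1 then 1 else 0)) (at_right (0::real))"
  proof (cases "z = 1")
    case True
    have "((\<lambda>e. 1) \<longlongrightarrow> (1::complex)) (at_right (0::real))" by simp
    moreover have "eventually (\<lambda>e. 1 = of_real e / (z - 1 + of_real e)) (at_right (0::real))"
      using True by (auto simp: eventually_at_filter)
    ultimately have "((\<lambda>e. of_real e / (z - 1 + of_real e)) \<longlongrightarrow> 1) (at_right (0::real))"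
      by (rule Lim_transform_eventually)
    then show ?thesis using True by simp
  next
    case False
    then show ?thesis by (auto intro!: tendsto_eq_intros)
  qed
  have "((\<lambda>e. of_real e / (z - 1 + of_real e) - of_real e * (deriv g (z + of_real e) / g (z + of_real e)) - of_nat k) \<longlongrightarrow> (if z = 1 then 1 else 0) - of_real 0 * (deriv g z / g z) - of_nat k) (at_right 0)"
    using gz by (intro tendsto_intros t1 tg) auto
  then have "((\<lambda>e. of_real e * mangoldt_series (z + of_real e)) \<longlongrightarrow> (if z = 1 then 1 else 0) - of_real 0 * (deriv g z / g z) - of_nat k) (at_right 0)"
    by (rule Lim_transform_eventually) 
       (use eq r(1) in \<open>auto simp: eventually_at_right_field intro!: exI[of _ r]\<close>)
  then have "((\<lambda>e. of_real e * mangoldt_series (z + of_real e)) \<longlongrightarrow> of_real ((if z = 1 then 1 else 0) - real k)) (at_right 0)"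
    by (rule tendsto_eq_rhs) auto
  then show ?thesis by (rule that[OF k0])
qed

text \<open>A zero of order k at a + it contributes -4k to the limit of the 3-4-1 inequality,
  against at most 3 from the pole at 1; hence k = 0. The argument treats a = 1 and a > 1
  alike.\<close>

theorem zeta_pole_nonzero:
  assumes z: "Re z \<ge> 1"
  shows "zeta_pole z \<noteq> 0"
proof (cases "z = 1")
  case False
  define a t where "a = Re z" and "t = Im z"
  define w where "w = complex_of_real a + \<i> * of_real (2 * t)"
  have zz: "z = complex_of_real a + \<i> * of_real t" by (simp add: a_def t_def complex_eq)
  \<comment> \<open>a + 2it = 1 would force t = 0 and a = 1, that is z = 1; so neither z nor w
    brings in a pole.\<close>
  have w1: "w \<noteq> 1" using False by (auto simp: w_def zz complex_eq_iff)
  have a: "a \<ge> 1" using z by (simp add: a_def)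
  have a1: "Re (complex_of_real a) \<ge> 1" and w2: "Re w \<ge> 1" using a by (auto simp: w_def)
  obtain k0 where "k0 = 0 \<longleftrightarrow> zeta_pole (of_real a) \<noteq> 0" and k0: "((\<lambda>e. of_real e * mangoldt_series (of_real a + of_real e)) \<longlongrightarrow> of_real ((if complex_of_real a = 1 then 1 else 0) - real k0)) (at_right 0)"
    using mangoldt_series_limit[OF a1] .
  obtain k where k: "k = 0 \<longleftrightarrow> zeta_pole z \<noteq> 0" "((\<lambda>e. of_real e * mangoldt_series (z + of_real e)) \<longlongrightarrow> of_real ((if z = 1 then 1 else 0) - real k)) (at_right 0)"
    using mangoldt_series_limit[OF z] .
  obtain k2 where "k2 = 0 \<longleftrightarrow> zeta_pole w \<noteq> 0" and k2: "((\<lambda>e. of_real e * mangoldt_series (w + of_real e)) \<longlongrightarrow> of_real ((if w = 1 then 1 else 0) - real k2)) (at_right 0)"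
    using mangoldt_series_limit[OF w2] .
  define h where "h = (\<lambda>e. 3 * Re (of_real e * mangoldt_series (of_real a + of_real e)) + 4 * Re (of_real e * mangoldt_series (z + of_real e))
     + Re (of_real e * mangoldt_series (w + of_real e)))"
  have lim: "(h \<longlongrightarrow> 3 * ((if complex_of_real a = 1 then 1 else 0) - real k0) + 4 * ((if z = 1 then 1 else 0) - real k) + ((if w = 1 then 1 else 0) - real k2)) (at_right 0)"
    unfolding h_def using tendsto_Re[OF k0] tendsto_Re[OF k(2)] tendsto_Re[OF k2] 
    by (intro tendsto_add tendsto_mult tendsto_const) simp_all
  have "eventually (\<lambda>e. h e \<ge> 0) (at_right 0)"
  proof (rule eventually_mono[OF eventually_at_right_less[of 0]])
    fix e :: real assume e: "0 < e"
    have "0 \<le> 3 * Re (mangoldt_series (of_real (a + e))) + 4 * Re (mangoldt_series (of_real (a + e) + \<i> * of_real t))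
      + Re (mangoldt_series (of_real (a + e) + \<i> * of_real (2 * t)))"
      using a e by (intro mangoldt_series_341) auto
    then have "0 \<le> e * (3 * Re (mangoldt_series (of_real (a + e))) + 4 * Re (mangoldt_series (of_real (a + e) + \<i> * of_real t))
      + Re (mangoldt_series (of_real (a + e) + \<i> * of_real (2 * t))))"
      using e by (intro mult_nonneg_nonneg) auto
    also have "\<dots> = h e"
      by (simp add: h_def zz w_def algebra_simps)
    finally show "h e \<ge> 0" .
  qed
  then have "0 \<le> 3 * ((if complex_of_real a = 1 then 1 else 0) - real k0) + 4 * ((if z = 1 then 1 else 0) - real k) + ((if w = 1 then 1 else 0) - real k2)"
    by (intro tendsto_lowerbound[OF lim]) auto
  then have "k = 0" using False w1 by (auto split: if_splits)
  then show ?thesis using k(1) by blast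
qed auto

text \<open>With P = \<open>zeta_pole\<close> the sum is -P' / P - (P - 1) / (s - 1): the poles of
  the two series at 1 cancel because P(1) = 1. \<open>Q\<close> fills the removable singularity, and
  P has no zero on the closed half-plane.\<close>

theorem mangoldt_minus_one_series_extension:
  obtains F :: "complex \<Rightarrow> complex" where "continuous_on {s. Re s \<ge> 1} F"
    "\<And>s. Re s > 1 \<Longrightarrow> (\<lambda>n. (mangoldt n - 1) * of_nat n powr (-s)) sums F s"
proof -
  define Q where "Q = (\<lambda>z. if z = 1 then deriv zeta_pole 1 else (zeta_pole z - zeta_pole 1) / (z - 1))"
  define F where "F = (\<lambda>s. - (deriv zeta_pole s / zeta_pole s) - Q s)"
  have sub: "{s. Re s \<ge> 1} \<subseteq> {s. Re s > 0}" by auto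
  have "Q holomorphic_on {s. Re s > 0}"
    unfolding Q_def by (intro pole_lemma_open zeta_pole_holomorphic open_Re_gt)
  then have "continuous_on {s. Re s \<ge> 1} Q"
    using continuous_on_subset holomorphic_on_imp_continuous_on sub by blast
  moreover have "continuous_on {s. Re s \<ge> 1} zeta_pole"
    using continuous_on_subset holomorphic_on_imp_continuous_on[OF zeta_pole_holomorphic] sub by blast
  moreover have "continuous_on {s. Re s \<ge> 1} (deriv zeta_pole)"
    using continuous_on_subset[OF holomorphic_on_imp_continuous_on[OF holomorphic_deriv[OF zeta_pole_holomorphic open_Re_gt]]] sub by blast
  ultimately have "continuous_on {s. Re s \<ge> 1} F"
    unfolding F_def using zeta_pole_nonzero by (intro continuous_intros) auto
  moreover have "(\<lambda>n. (mangoldt n - 1) * of_nat n powr (-s)) sums F s" if s: "Re s > 1" for s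
  proof -
    have s1: "s \<noteq> 1" using s by auto
    have "(\<lambda>n. mangoldt n * of_nat n powr (-s) - of_nat n powr (-s)) sums (mangoldt_series s - zeta s)"
      by (intro sums_diff mangoldt_series_sums zeta_sums s)
    moreover have "mangoldt_series s - zeta s = F s"
    proof -
      have z: "zeta_pole s \<noteq> 0" using zeta_pole_nonzero s by simp
      have zeta: "zeta s = zeta_pole s / (s - 1)" using zeta_pole_eq[OF s] s1 by simp
      have d: "deriv zeta_pole s = zeta s - (s - 1) * (mangoldt_series s * zeta s)"
        by (rule DERIV_imp_deriv[OF zeta_pole_DERIV[OF s]])
      have d': "deriv zeta_pole s = zeta_pole s / (s - 1) - mangoldt_series s * zeta_pole s"
        unfolding d zeta using s1 by simp
      have "deriv zeta_pole s / zeta_pole s = 1 / (s - 1) - mangoldt_series s"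
        unfolding d' using z by (simp add: diff_divide_distrib)
      then show ?thesis using s1 unfolding F_def Q_def zeta by (simp add: field_simps)
    qed
    ultimately show ?thesis by (simp add: algebra_simps)
  qed
  ultimately show ?thesis by (rule that)
qed

section \<open>Primes in short intervals\<close>

text \<open>The Fourier transform of the triangle 1 - |t| / l on [-l, l], equal to 4 sin^2 (l v / 2)
  / (l v^2) away from 0. Its total mass is 2 pi for every l.\<close>

definition fejer :: "real \<Rightarrow> real \<Rightarrow> real" where
  "fejer l v = (if v = 0 then l else 2 * (1 - cos (l * v)) / (l * v\<^sup>2))"

lemma one_minus_cos: "1 - cos x = 2 * (sin (x / 2))\<^sup>2" for x :: real
  using cos_double_sin[of "x / 2"] by simp

lemma fejer_nonneg: "l > 0 \<Longrightarrow> fejer l v \<ge> 0"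
  by (simp add: fejer_def)

lemma fejer_le: 
  assumes "l > 0" shows "fejer l v \<le> l"
proof (cases "v = 0")
  case False
  have "\<bar>sin (l * v / 2)\<bar> \<le> \<bar>l * v / 2\<bar>" by (rule abs_sin_x_le_abs_x)
  then have "(sin (l * v / 2))\<^sup>2 \<le> (l * v / 2)\<^sup>2" using abs_le_square_iff by blast
  then have "2 * (1 - cos (l * v)) \<le> l * (l * v\<^sup>2)"
    unfolding one_minus_cos by (simp add: power2_eq_square mult_ac)
  then show ?thesis using assms False by (simp add: fejer_def divide_le_eq)
qed (simp add: fejer_def)

lemma fejer_le_square:
  assumes "l > 0" "v \<noteq> 0" shows "fejer l v \<le> 4 / (l * v\<^sup>2)"
proof -
  have "2 * (1 - cos (l * v)) \<le> 4"
    by (smt (verit) cos_ge_minus_one)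
  then have "2 * (1 - cos (l * v)) / (l * v\<^sup>2) \<le> 4 / (l * v\<^sup>2)"
    using assms by (intro divide_right_mono) auto
  then show ?thesis using assms unfolding fejer_def by simp
qed

text \<open>The 5 adds the bound 1 for the kernel and the bound 4 for the kernel times v^2.\<close>

lemma fejer_1_le: "fejer 1 v \<le> 5 / (1 + v\<^sup>2)"
proof (cases "v = 0")
  case False
  have "fejer 1 v * v\<^sup>2 \<le> 4"
    using fejer_le_square[of 1 v] False by (simp add: field_simps)
  moreover have "fejer 1 v \<le> 1" by (rule fejer_le) simp
  ultimately have "fejer 1 v * (1 + v\<^sup>2) \<le> 5" by (simp add: algebra_simps)
  then show ?thesis by (simp add: pos_le_divide_eq add_pos_nonneg)
qed (simp add: fejer_def)

lemma fejer_1_ge: "fejer 1 v \<ge> 2 * (1 - cos v) / (1 + v\<^sup>2)"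
proof (cases "v = 0")
  case False
  then show ?thesis by (simp add: fejer_def frac_le)
qed (simp add: fejer_def)

text \<open>\<open>fejer 1\<close> vanishes at the nonzero multiples of 2 pi, so alone it cannot
  dominate the Cauchy kernel. The shift by pi turns 1 - cos v into 1 + cos v, and the two numerators
  add up to 4.\<close>

lemma fejer_1_shift_ge: "1 / (1 + v\<^sup>2) \<le> 9 * (fejer 1 v + fejer 1 (v - pi))"
proof -
  have "\<bar>v\<bar> * 2 \<le> 1 + v\<^sup>2"
    using sum_squares_bound[of "\<bar>v\<bar>" 1] by (simp add: power2_eq_square)
  have p: "0 \<le> pi" "pi \<le> 4" using pi_less_4 by auto
  have "pi\<^sup>2 \<le> 4\<^sup>2" using p by (intro power_mono) auto
  then have p16: "pi\<^sup>2 \<le> 16" by simp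
  have v0: "0 \<le> v\<^sup>2" by simp
  have "(v - pi)\<^sup>2 \<le> 2 * v\<^sup>2 + 2 * pi\<^sup>2"
    using sum_squares_bound[of v "- pi"] by (simp add: power2_eq_square algebra_simps)
  \<comment> \<open>From pi^2 \<le> 16 the left side is at most 33 + 2 v^2. The final factor 9
    rounds up 33 / 4.\<close>
  then have b: "1 + (v - pi)\<^sup>2 \<le> 33 * (1 + v\<^sup>2)"
    using p16 v0 unfolding distrib_left by linarith
  have pos: "0 < 1 + v\<^sup>2" "0 < 1 + (v - pi)\<^sup>2" by (simp_all add: add_pos_nonneg)
  have "2 * (1 - cos v) / (33 * (1 + v\<^sup>2)) \<le> 2 * (1 - cos v) / (1 + v\<^sup>2)"
    using pos by (intro divide_left_mono mult_pos_pos) auto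
  also have "\<dots> \<le> fejer 1 v" by (rule fejer_1_ge)
  finally have 1: "2 * (1 - cos v) / (33 * (1 + v\<^sup>2)) \<le> fejer 1 v" .
  have c: "cos (v - pi) = - cos v" by (simp add: cos_diff)
  have c2: "0 \<le> 2 * (1 + cos v)" by (smt (verit) cos_ge_minus_one)
  have "2 * (1 + cos v) / (33 * (1 + v\<^sup>2)) \<le> 2 * (1 + cos v) / (1 + (v - pi)\<^sup>2)"
    by (rule divide_left_mono[OF b c2 mult_pos_pos[OF _ pos(2)]]) (use pos in auto)
  also have "\<dots> \<le> fejer 1 (v - pi)" using fejer_1_ge[of "v - pi"] c by simp
  finally have 2: "2 * (1 + cos v) / (33 * (1 + v\<^sup>2)) \<le> fejer 1 (v - pi)" .
  have "4 / (33 * (1 + v\<^sup>2)) = 2 * (1 - cos v) / (33 * (1 + v\<^sup>2)) + 2 * (1 + cos v) / (33 * (1 + v\<^sup>2))"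
    by (simp add: add_divide_distrib[symmetric])
  also have "\<dots> \<le> fejer 1 v + fejer 1 (v - pi)" using 1 2 by (rule add_mono)
  finally have 3: "4 / (33 * (1 + v\<^sup>2)) \<le> fejer 1 v + fejer 1 (v - pi)" .
  have eq: "1 / D = (33 / 4) * (4 / (33 * D))" for D :: real by simp
  have "1 / (1 + v\<^sup>2) \<le> (33 / 4) * (fejer 1 v + fejer 1 (v - pi))"
    unfolding eq[of "1 + v\<^sup>2"] using 3 by (rule mult_left_mono) simp
  also have "\<dots> \<le> 9 * (fejer 1 v + fejer 1 (v - pi))"
    by (rule mult_right_mono) (simp_all add: fejer_nonneg)
  finally show ?thesis .
qed

text \<open>The derivative of sin y - y / 2 is cos y - 1 / 2, which is nonnegative on [0, 1] because
  1 < pi / 3.\<close>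

lemma sin_ge_half:
  fixes x :: real
  assumes "0 \<le> x" "x \<le> 1"
  shows "sin x \<ge> x / 2"
proof -
  have "sin 0 - 0 / 2 \<le> sin x - x / 2"
  proof (rule DERIV_nonneg_imp_nondecreasing[OF assms(1)])
    fix y :: real assume y: "0 \<le> y" "y \<le> x"
    have "cos (pi / 3) \<le> cos y"
      using y assms pi_gt3 by (intro cos_monotone_0_pi_le) auto
    then have "0 \<le> cos y - 1 / 2" by (simp add: cos_60)
    moreover have "((\<lambda>x. sin x - x / 2) has_real_derivative cos y - 1 / 2) (at y)"
      by (auto intro!: derivative_eq_intros)
    ultimately show "\<exists>d. ((\<lambda>x. sin x - x / 2) has_real_derivative d) (at y) \<and> 0 \<le> d"
      by blast
  qed
  then show ?thesis by simp
qed

text \<open>With x = l |v| / 2 in [0, 1], sin x \<ge> x / 2 gives 2 (1 - cos (l v)) = 4 sin^2 x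
  \<ge> x^2 = l^2 v^2 / 4.\<close>

lemma fejer_ge_quarter:
  assumes "l > 0" "\<bar>v\<bar> \<le> 1 / l" shows "fejer l v \<ge> l / 4"
proof (cases "v = 0")
  case False
  define x where "x = l * \<bar>v\<bar> / 2"
  have x: "0 \<le> x" "x \<le> 1" using assms by (auto simp: x_def field_simps)
  have "(x / 2)\<^sup>2 \<le> (sin x)\<^sup>2"
    using sin_ge_half[OF x] x by (intro power_mono) auto
  moreover have "cos (l * v) = cos (l * \<bar>v\<bar>)"
    by (simp add: abs_if)
  ultimately have "2 * (1 - cos (l * v)) \<ge> x\<^sup>2"
    using one_minus_cos[of "l * \<bar>v\<bar>"] by (simp add: x_def power2_eq_square)
  then have "2 * (1 - cos (l * v)) \<ge> (l / 4) * (l * v\<^sup>2)"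
    by (simp add: x_def power_divide power_mult_distrib power2_abs) (simp add: power2_eq_square mult_ac)
  then show ?thesis
    using assms False unfolding fejer_def by (simp add: pos_le_divide_eq)
qed (use assms in \<open>simp add: fejer_def\<close>)

text \<open>Integration by parts. The half appears because only t \<ge> 0 is used, where the
  transform of the even triangle is a cosine integral.\<close>

lemma fejer_has_integral:
  assumes "l > 0"
  shows "((\<lambda>t. (1 - t / l) * cos (t * v)) has_integral fejer l v / 2) {0..l}"
proof (cases "v = 0")
  case True
  have "((\<lambda>t. 1 - t / l) has_integral (l - l\<^sup>2 / (2 * l)) - (0 - 0\<^sup>2 / (2 * l))) {0..l}"
    using assms by (intro fundamental_theorem_of_calculus)
      (auto intro!: derivative_eq_intros simp: has_real_derivative_iff_has_vector_derivative[symmetric])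
  then show ?thesis using assms True by (simp add: fejer_def power2_eq_square)
next
  case False
  have "((\<lambda>t. (1 - t / l) * cos (t * v)) has_integral
     ((1 - l / l) * sin (l * v) / v - cos (l * v) / (l * v\<^sup>2)) - ((1 - 0 / l) * sin (0 * v) / v - cos (0 * v) / (l * v\<^sup>2))) {0..l}"
  proof (rule fundamental_theorem_of_calculus)
    fix t assume "t \<in> {0..l}"
    have "((\<lambda>t. (1 - t / l) * sin (t * v) / v - cos (t * v) / (l * v\<^sup>2)) has_real_derivative
      ((- (1 / l)) * sin (t * v) + (1 - t / l) * (cos (t * v) * v)) / v - (- sin (t * v) * v) / (l * v\<^sup>2)) (at t)"
      using assms False by (auto intro!: derivative_eq_intros simp: field_simps)
    also have "((- (1 / l)) * sin (t * v) + (1 - t / l) * (cos (t * v) * v)) / v - (- sin (t * v) * v) / (l * v\<^sup>2) = (1 - t / l) * cos (t * v)"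
      using assms False by (simp add: field_simps power2_eq_square)
    finally show "((\<lambda>t. (1 - t / l) * sin (t * v) / v - cos (t * v) / (l * v\<^sup>2)) has_vector_derivative (1 - t / l) * cos (t * v)) (at t within {0..l})"
      using has_vector_derivative_at_within has_real_derivative_iff_has_vector_derivative by blast
  qed (use assms in auto)
  also have "((1 - l / l) * sin (l * v) / v - cos (l * v) / (l * v\<^sup>2)) - ((1 - 0 / l) * sin (0 * v) / v - cos (0 * v) / (l * v\<^sup>2)) = fejer l v / 2"
    using assms False by (simp add: fejer_def diff_divide_distrib)
  finally show ?thesis .
qed

section \<open>Oscillating integrals and the comparison of the two averages\<close>

lemma riemann_lebesgue:
  fixes f :: "real \<Rightarrow> complex"
  assumes f: "continuous_on {a..b} f" and ab: "a < b" and e: "e > 0"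
  shows "\<exists>T0. \<forall>T\<ge>T0. norm (integral {a..b} (\<lambda>t. f t * exp (\<i> * of_real (T * t)))) \<le> e"
proof -
  \<comment> \<open>\<open>f\<close> is only continuous, so integration by parts is done for a
    polynomial function within \<open>d\<close> of it. The replacement costs e / 2 over the
    interval, and the oscillation of the polynomial the other e / 2.\<close>
  define d where "d = (e / 2) / (b - a)"
  have d: "d > 0" using ab e by (simp add: d_def)
  obtain p where p: "polynomial_function p" "\<And>x. x \<in> {a..b} \<Longrightarrow> norm (f x - p x) < d"
    using Stone_Weierstrass_polynomial_function[of "{a..b}" f d] f d by auto
  obtain p' where p': "polynomial_function p'" "\<And>x. (p has_vector_derivative p' x) (at x)"
    using has_vector_derivative_polynomial_function[OF p(1)] by blast
  have cp: "continuous_on S p" "continuous_on S p'" for S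
    using p(1) p'(1) continuous_on_polymonial_function by blast+
  \<comment> \<open>Boundary terms and derivative term together: after integration by parts the
    integral is at most M / T.\<close>
  define M where "M = norm (p b) + norm (p a) + integral {a..b} (\<lambda>t. norm (p' t))"
  have M: "M \<ge> 0" unfolding M_def by (intro add_nonneg_nonneg integral_nonneg integrable_continuous_real continuous_intros cp) auto
  have "norm (integral {a..b} (\<lambda>t. f t * exp (\<i> * of_real (T * t)))) \<le> e" if T: "T \<ge> 2 * (M + 1) / e" for T
  proof -
    have T0: "T > 0" using T e M by (smt (verit) divide_pos_pos)
    define E where "E = (\<lambda>t::real. exp (\<i> * of_real (T * t)))"
    have nE: "norm (E t) = 1" for t by (simp add: E_def)
    have cE: "continuous_on S E" for S unfolding E_def by (intro continuous_intros)
    define c where "c = \<i> * complex_of_real T"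
    have c: "c \<noteq> 0" "norm c = T" using T0 by (auto simp: c_def norm_mult)
    have "((\<lambda>t. p t * E t + p' t * E t / c) has_integral (p b * E b / c - p a * E a / c)) {a..b}"
    proof (rule fundamental_theorem_of_calculus)
      fix t
      have "(E has_vector_derivative c * E t) (at t)"
        unfolding E_def c_def by (auto intro!: derivative_eq_intros has_vector_derivative_real_field simp: algebra_simps)
      then have "((\<lambda>t. p t * E t / c) has_vector_derivative (p t * (c * E t) + p' t * E t) / c) (at t)"
        by (intro has_vector_derivative_divide has_vector_derivative_mult p')
      also have "(p t * (c * E t) + p' t * E t) / c = p t * E t + p' t * E t / c"
        using c(1) by (simp add: field_simps)
      finally show "((\<lambda>t. p t * E t / c) has_vector_derivative p t * E t + p' t * E t / c) (at t within {a..b})"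
        by (rule has_vector_derivative_at_within)
    qed (use ab in auto)
    moreover have "((\<lambda>t. p' t * E t / c) has_integral integral {a..b} (\<lambda>t. p' t * E t / c)) {a..b}"
      using c(1) by (intro integrable_integral integrable_continuous_real continuous_intros cp cE) auto
    ultimately have "((\<lambda>t. (p t * E t + p' t * E t / c) - p' t * E t / c) has_integral ((p b * E b / c - p a * E a / c) - integral {a..b} (\<lambda>t. p' t * E t / c))) {a..b}"
      by (rule has_integral_diff)
    then have ip: "integral {a..b} (\<lambda>t. p t * E t) = (p b * E b / c - p a * E a / c) - integral {a..b} (\<lambda>t. p' t * E t / c)"
      by (simp add: integral_unique)
    have "norm (integral {a..b} (\<lambda>t. p' t * E t / c)) \<le> integral {a..b} (\<lambda>t. norm (p' t) / T)"
      using c T0 by (intro integral_norm_bound_integral integrable_continuous_real continuous_intros cp cE) (auto simp: norm_mult norm_divide nE)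
    also have "\<dots> = integral {a..b} (\<lambda>t. norm (p' t)) / T"
      by simp
    finally have 1: "norm (integral {a..b} (\<lambda>t. p' t * E t / c)) \<le> integral {a..b} (\<lambda>t. norm (p' t)) / T" .
    have "norm (integral {a..b} (\<lambda>t. p t * E t)) \<le> norm (p b * E b / c) + norm (p a * E a / c) + norm (integral {a..b} (\<lambda>t. p' t * E t / c))"
      unfolding ip by (smt (verit) norm_triangle_ineq4)
    also have "\<dots> \<le> M / T"
      using 1 by (simp add: norm_mult norm_divide nE c(2) M_def add_divide_distrib)
    also have "\<dots> \<le> e / 2"
      using T T0 e M by (simp add: field_simps)
    finally have A: "norm (integral {a..b} (\<lambda>t. p t * E t)) \<le> e / 2" .
    have "norm (integral {a..b} (\<lambda>t. f t * E t - p t * E t)) \<le> integral {a..b} (\<lambda>t. d)"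
    proof (intro integral_norm_bound_integral integrable_continuous_real continuous_intros cp cE f)
      fix t assume "t \<in> {a..b}"
      have "norm (f t * E t - p t * E t) = norm (f t - p t)"
        unfolding left_diff_distrib[symmetric] norm_mult nE by simp
      then show "norm (f t * E t - p t * E t) \<le> d" using p(2)[OF \<open>t \<in> {a..b}\<close>] by simp
    qed
    also have "\<dots> = (b - a) * d" using ab by simp
    also have "\<dots> = e / 2" using ab unfolding d_def by (subst times_divide_eq_right, subst nonzero_mult_div_cancel_left) auto
    also have "integral {a..b} (\<lambda>t. f t * E t - p t * E t) = integral {a..b} (\<lambda>t. f t * E t) - integral {a..b} (\<lambda>t. p t * E t)"
      by (intro integral_diff integrable_continuous_real continuous_intros cp cE f)
    finally have B: "norm (integral {a..b} (\<lambda>t. f t * E t) - integral {a..b} (\<lambda>t. p t * E t)) \<le> e / 2" .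
    have "norm (integral {a..b} (\<lambda>t. f t * E t)) \<le> e"
      using A B norm_triangle_sub[of "integral {a..b} (\<lambda>t. f t * E t)" "integral {a..b} (\<lambda>t. p t * E t)"] by linarith
    then show ?thesis by (simp add: E_def)
  qed
  then show ?thesis by blast
qed

text \<open>The factor n^(-it) and exp(iTt) combine to exp(it(T - ln n)). The real part, integrated
  against the triangle over t \<ge> 0, is half a kernel centred at T, hence the 2. Since a > 1,
  convergence is uniform in t and the integration may be done termwise.\<close>

lemma fejer_series:
  assumes F: "\<And>s. Re s > 1 \<Longrightarrow> (\<lambda>n. (mangoldt n - 1) * of_nat n powr (-s)) sums F s"
    and Fc: "continuous_on {s. Re s \<ge> 1} F" and l: "l > 0" and a: "a > 1"
  shows "(\<lambda>n. (mangoldt n - 1) * real n powr (-a) * fejer l (T - ln (real n))) sums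
    (2 * Re (integral {0..l} (\<lambda>t. of_real (1 - t / l) * F (of_real a + \<i> * of_real t) * exp (\<i> * of_real (T * t)))))"
proof -
  define f where "f = (\<lambda>n t. (mangoldt n - 1) * real n powr (-a) * ((1 - t / l) * cos (t * (T - ln (real n)))))"
  define g where "g = (\<lambda>t. Re (of_real (1 - t / l) * F (of_real a + \<i> * of_real t) * exp (\<i> * of_real (T * t))))"
  have fs: "(\<lambda>n. f n t) sums g t" for t
  proof -
    have "(\<lambda>n. of_real (1 - t / l) * ((mangoldt n - 1) * of_nat n powr (-(of_real a + \<i> * of_real t))) * exp (\<i> * of_real (T * t))) sums
       (of_real (1 - t / l) * F (of_real a + \<i> * of_real t) * exp (\<i> * of_real (T * t)))"
      using a by (intro sums_mult sums_mult2 F) auto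
    then have "(\<lambda>n. Re (of_real (1 - t / l) * ((mangoldt n - 1) * of_nat n powr (-(of_real a + \<i> * of_real t))) * exp (\<i> * of_real (T * t)))) sums g t"
      unfolding g_def by (rule sums_Re)
    moreover have "Re (of_real (1 - t / l) * ((mangoldt n - 1) * of_nat n powr (-(of_real a + \<i> * of_real t))) * exp (\<i> * of_real (T * t))) = f n t" for n
    proof (cases "n = 0")
      case False
      then have n: "of_nat n powr (-(of_real a + \<i> * of_real t)) = exp (complex_of_real (- a * ln (real n)) + \<i> * complex_of_real (- t * ln (real n)))"
        by (simp add: powr_def Ln_of_nat algebra_simps)
      have "of_nat n powr (-(of_real a + \<i> * of_real t)) * exp (\<i> * of_real (T * t)) = exp (complex_of_real (- a * ln (real n)) + \<i> * complex_of_real (t * (T - ln (real n))))"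
        unfolding n exp_add[symmetric] by (simp add: algebra_simps)
      then have R: "Re (of_nat n powr (-(of_real a + \<i> * of_real t)) * exp (\<i> * of_real (T * t))) = real n powr (-a) * cos (t * (T - ln (real n)))"
        using False by (simp add: Re_exp powr_def)
      have "of_real (1 - t / l) * ((mangoldt n - 1) * of_nat n powr (-(of_real a + \<i> * of_real t))) * exp (\<i> * of_real (T * t))
        = of_real ((1 - t / l) * (mangoldt n - 1)) * (of_nat n powr (-(of_real a + \<i> * of_real t)) * exp (\<i> * of_real (T * t)))"
        by (simp add: mult_ac)
      then have "Re (of_real (1 - t / l) * ((mangoldt n - 1) * of_nat n powr (-(of_real a + \<i> * of_real t))) * exp (\<i> * of_real (T * t)))
        = ((1 - t / l) * (mangoldt n - 1)) * (real n powr (-a) * cos (t * (T - ln (real n))))"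
        unfolding R[symmetric] by (simp only: Re_complex_of_real Im_complex_of_real times_complex.sel)
      then show ?thesis by (simp add: f_def mult_ac)
    qed (simp add: f_def)
    ultimately show ?thesis by (simp only:)
  qed
  have "summable (\<lambda>n. ln (real n) * real n powr (-a) + real n powr (-a))"
    using a by (intro summable_add summable_ln_powr) (auto simp: summable_real_powr_iff)
  then have sm: "summable (\<lambda>n. (ln (real n) + 1) * real n powr (-a))"
    by (simp add: algebra_simps)
  have ul: "uniform_limit {0..l} (\<lambda>N t. \<Sum>n<N. f n t) (\<lambda>t. \<Sum>n. f n t) sequentially"
  proof (rule Weierstrass_m_test[OF _ sm])
    fix n t assume t: "t \<in> {0..l}"
    have 1: "\<bar>mangoldt n - 1 :: real\<bar> \<le> ln (real n) + 1" if "n > 0"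
      using mangoldt_nonneg[of n] mangoldt_le_ln'[of n] by linarith
    have "\<bar>1 - t / l\<bar> \<le> 1" using t l by (auto simp: field_simps)
    then have "\<bar>(1 - t / l) * cos (t * (T - ln (real n)))\<bar> \<le> 1 * 1"
      unfolding abs_mult by (intro mult_mono) auto
    then have "\<bar>(mangoldt n - 1) * real n powr (-a)\<bar> * \<bar>(1 - t / l) * cos (t * (T - ln (real n)))\<bar> \<le> ((ln (real n) + 1) * real n powr (-a)) * 1"
      using 1 by (intro mult_mono) (cases "n = 0"; auto simp: abs_mult intro!: mult_right_mono)+
    then show "norm (f n t) \<le> (ln (real n) + 1) * real n powr (-a)"
      by (simp add: f_def abs_mult)
  qed
  have gs: "(\<lambda>t. \<Sum>n. f n t) = g" using fs by (auto simp: sums_iff)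
  have cf: "continuous_on {0..l} (\<lambda>t. \<Sum>n<N. f n t)" for N
    unfolding f_def by (intro continuous_intros) (use l in auto)
  obtain I J where IJ: "\<And>N. ((\<lambda>t. \<Sum>n<N. f n t) has_integral I N) {0..l}" "(g has_integral J) {0..l}" "I \<longlonglongrightarrow> J"
    using uniform_limit_integral[OF ul cf] unfolding gs by auto
  have "((\<lambda>t. \<Sum>n<N. f n t) has_integral (\<Sum>n<N. (mangoldt n - 1) * real n powr (-a) * (fejer l (T - ln (real n)) / 2))) {0..l}" for N
    unfolding f_def by (intro has_integral_sum has_integral_mult_right fejer_has_integral l) auto
  then have "I = (\<lambda>N. \<Sum>n<N. (mangoldt n - 1) * real n powr (-a) * (fejer l (T - ln (real n)) / 2))"
    using IJ(1) has_integral_unique by blast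
  with IJ(3) have "(\<lambda>n. (mangoldt n - 1) * real n powr (-a) * (fejer l (T - ln (real n)) / 2)) sums J"
    by (simp add: sums_def)
  from sums_mult[OF this, of 2] have S: "(\<lambda>n. (mangoldt n - 1) * real n powr (-a) * fejer l (T - ln (real n))) sums (2 * J)"
    by simp
  have Fa: "continuous_on {0..l} (\<lambda>t. F (of_real a + \<i> * of_real t))"
    using a by (intro continuous_on_compose2[OF Fc] continuous_intros) auto
  have "(\<lambda>t. of_real (1 - t / l) * F (of_real a + \<i> * of_real t) * exp (\<i> * of_real (T * t))) integrable_on {0..l}"
    using l by (intro integrable_continuous_real continuous_intros Fa) auto
  then have "(g has_integral Re (integral {0..l} (\<lambda>t. of_real (1 - t / l) * F (of_real a + \<i> * of_real t) * exp (\<i> * of_real (T * t))))) {0..l}"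
    unfolding g_def by (intro has_integral_Re integrable_integral)
  then have "J = Re (integral {0..l} (\<lambda>t. of_real (1 - t / l) * F (of_real a + \<i> * of_real t) * exp (\<i> * of_real (T * t))))"
    using IJ(2) has_integral_unique by blast
  with S show ?thesis by simp
qed

lemma summable_bounded_weight:
  fixes c :: "nat \<Rightarrow> real"
  assumes "summable c" "\<And>n. c n \<ge> 0" "\<And>n. \<bar>f n\<bar> \<le> K"
  shows "summable (\<lambda>n. c n * f n)"
proof (rule summable_comparison_test')
  show "summable (\<lambda>n. c n * K)" using assms(1) by (rule summable_mult2)
  show "norm (c n * f n) \<le> c n * K" for n
    using assms(2,3)[of n] by (simp add: abs_mult mult_left_mono)
qed

lemma weighted_summable:
  assumes "a > 1" "\<And>n. \<bar>f n\<bar> \<le> K"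
  shows "summable (\<lambda>n. mangoldt n * real n powr (-a) * f n)" "summable (\<lambda>n. real n powr (-a) * f n)"
proof -
  show "summable (\<lambda>n. mangoldt n * real n powr (-a) * f n)"
    using assms by (intro summable_bounded_weight[where K = K] summable_mangoldt) (auto simp: mangoldt_nonneg)
  have "summable (\<lambda>n. real n powr (-a))"
    using assms(1) by (simp add: summable_real_powr_iff)
  then show "summable (\<lambda>n. real n powr (-a) * f n)"
    using assms(2) by (intro summable_bounded_weight[where K = K]) auto
qed

lemma abs_fejer_le: "l > 0 \<Longrightarrow> \<bar>fejer l v\<bar> \<le> l"
  using fejer_nonneg fejer_le by (simp add: abs_of_nonneg)

text \<open>On the line a = 1 the integral from \<open>fejer_series\<close> tends to 0 by the
  Riemann-Lebesgue lemma. Uniform continuity of the extension on the rectangle [1, 2] x [0, l]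
  carries the estimate to a near 1; as the oscillating factor has modulus 1, the admissible range of
  a does not depend on T.\<close>

lemma fejer_average_close:
  assumes l: "l > 0" and e: "e > 0"
  shows "\<exists>T0 a0. a0 > 1 \<and> (\<forall>T\<ge>T0. \<forall>a. 1 < a \<longrightarrow> a < a0 \<longrightarrow>
    \<bar>(\<Sum>n. mangoldt n * real n powr (-a) * fejer l (T - ln (real n))) - (\<Sum>n. real n powr (-a) * fejer l (T - ln (real n)))\<bar> \<le> e)"
proof -
  obtain F where Fc: "continuous_on {s. Re s \<ge> 1} F"
    and F: "\<And>s. Re s > 1 \<Longrightarrow> (\<lambda>n. (mangoldt n - 1) * of_nat n powr (-s)) sums F s"
    using mangoldt_minus_one_series_extension by metis
  define C where "C = cbox (Complex 1 0) (Complex 2 l)"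
  have Cin: "Complex x y \<in> C \<longleftrightarrow> 1 \<le> x \<and> x \<le> 2 \<and> 0 \<le> y \<and> y \<le> l" for x y
    by (auto simp: C_def in_cbox_complex_iff)
  have "C \<subseteq> {s. Re s \<ge> 1}" by (auto simp: C_def in_cbox_complex_iff)
  then have "uniformly_continuous_on C F"
    using Fc by (intro compact_uniformly_continuous continuous_on_subset[OF Fc]) (auto simp: C_def)
  moreover have e': "e / (4 * l) > 0" using l e by simp
  ultimately obtain d where d: "d > 0" "\<And>x y. x \<in> C \<Longrightarrow> y \<in> C \<Longrightarrow> dist y x < d \<Longrightarrow> dist (F y) (F x) < e / (4 * l)"
    unfolding uniformly_continuous_on_def by meson
  define G where "G = (\<lambda>a t. of_real (1 - t / l) * F (of_real a + \<i> * of_real t))"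
  have Gc: "continuous_on {0..l} (G a)" if "a \<ge> 1" for a
    unfolding G_def using that l by (intro continuous_intros continuous_on_compose2[OF Fc]) auto
  obtain T0 where T0: "\<And>T. T \<ge> T0 \<Longrightarrow> norm (integral {0..l} (\<lambda>t. G 1 t * exp (\<i> * of_real (T * t)))) \<le> e / 4"
    using riemann_lebesgue[OF Gc[of 1] l, of "e / 4"] e by auto
  have main: "\<bar>(\<Sum>n. mangoldt n * real n powr (-a) * fejer l (T - ln (real n))) - (\<Sum>n. real n powr (-a) * fejer l (T - ln (real n)))\<bar> \<le> e"
    if T: "T \<ge> T0" and a: "1 < a" "a < 1 + min d 1" for T a
  proof -
    define E where "E = (\<lambda>t. exp (\<i> * complex_of_real (T * t)))"
    have nE: "norm (E t) = 1" for t by (simp add: E_def)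
    have cE: "continuous_on S E" for S unfolding E_def by (intro continuous_intros)
    have "norm (integral {0..l} (\<lambda>t. G a t * E t - G 1 t * E t)) \<le> integral {0..l} (\<lambda>t. e / (4 * l))"
    proof (intro integral_norm_bound_integral integrable_continuous_real continuous_intros Gc cE)
      fix t assume t: "t \<in> {0..l}"
      have "dist (F (Complex a t)) (F (Complex 1 t)) < e / (4 * l)"
      proof (rule d(2))
        show "Complex 1 t \<in> C" "Complex a t \<in> C" using t a by (auto simp: Cin)
        have "Complex a t - Complex 1 t = of_real (a - 1)" by (simp add: complex_eq_iff)
        then have "dist (Complex a t) (Complex 1 t) = \<bar>a - 1\<bar>"
          unfolding dist_norm by (metis norm_of_real)
        then show "dist (Complex a t) (Complex 1 t) < d" using a by simp
      qed
      then have 1: "norm (F (of_real a + \<i> * of_real t) - F (of_real 1 + \<i> * of_real t)) \<le> e / (4 * l)"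
        by (simp add: dist_norm Complex_eq mult.commute)
      have "\<bar>1 - t / l\<bar> \<le> 1" using t l by (auto simp: field_simps)
      then have 2: "norm (complex_of_real (1 - t / l)) \<le> 1" by (simp only: norm_of_real)
      have "G a t * E t - G 1 t * E t = of_real (1 - t / l) * (F (of_real a + \<i> * of_real t) - F (of_real 1 + \<i> * of_real t)) * E t"
        unfolding G_def by (simp only: algebra_simps)
      then have "norm (G a t * E t - G 1 t * E t) = norm (complex_of_real (1 - t / l)) * norm (F (of_real a + \<i> * of_real t) - F (of_real 1 + \<i> * of_real t))"
        by (simp only: norm_mult nE mult_1_right)
      also have "\<dots> \<le> 1 * (e / (4 * l))"
        using 1 2 e' by (intro mult_mono) auto
      finally show "norm (G a t * E t - G 1 t * E t) \<le> e / (4 * l)" by simp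
    qed (use a in auto)
    also have "\<dots> = e / 4" using l by simp
    also have "integral {0..l} (\<lambda>t. G a t * E t - G 1 t * E t) = integral {0..l} (\<lambda>t. G a t * E t) - integral {0..l} (\<lambda>t. G 1 t * E t)"
      using a by (intro integral_diff integrable_continuous_real continuous_intros Gc cE) auto
    finally have A: "norm (integral {0..l} (\<lambda>t. G a t * E t) - integral {0..l} (\<lambda>t. G 1 t * E t)) \<le> e / 4" .
    \<comment> \<open>e / 4 from each of the two approximations; the factor 2 in
      \<open>fejer_series\<close> turns their sum into e.\<close>
    have B: "norm (integral {0..l} (\<lambda>t. G a t * E t)) \<le> e / 2"
      using A T0[OF T] norm_triangle_sub[of "integral {0..l} (\<lambda>t. G a t * E t)" "integral {0..l} (\<lambda>t. G 1 t * E t)"]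
      unfolding E_def by linarith
    have "(\<lambda>n. (mangoldt n - 1) * real n powr (-a) * fejer l (T - ln (real n))) sums (2 * Re (integral {0..l} (\<lambda>t. G a t * E t)))"
      unfolding G_def E_def using fejer_series[OF F Fc l a(1), of T] .
    moreover have "(\<lambda>n. mangoldt n * real n powr (-a) * fejer l (T - ln (real n)) - real n powr (-a) * fejer l (T - ln (real n))) sums
       ((\<Sum>n. mangoldt n * real n powr (-a) * fejer l (T - ln (real n))) - (\<Sum>n. real n powr (-a) * fejer l (T - ln (real n))))"
      using weighted_summable[OF a(1) abs_fejer_le[OF l]] by (intro sums_diff summable_sums)
    then have "(\<lambda>n. (mangoldt n - 1) * real n powr (-a) * fejer l (T - ln (real n))) sums
       ((\<Sum>n. mangoldt n * real n powr (-a) * fejer l (T - ln (real n))) - (\<Sum>n. real n powr (-a) * fejer l (T - ln (real n))))"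
      by (simp add: algebra_simps)
    ultimately have "(\<Sum>n. mangoldt n * real n powr (-a) * fejer l (T - ln (real n))) - (\<Sum>n. real n powr (-a) * fejer l (T - ln (real n))) = 2 * Re (integral {0..l} (\<lambda>t. G a t * E t))"
      using sums_unique2 by blast
    then show ?thesis using B abs_Re_le_cmod[of "integral {0..l} (\<lambda>t. G a t * E t)"] by simp
  qed
  show ?thesis
    by (rule exI[of _ T0], rule exI[of _ "1 + min d 1"]) (use main d(1) in auto)
qed

section \<open>Upper and lower bounds for the averages\<close>

lemma arctan_ln_step:
  assumes "n > 0"
  shows "1 / (real n * (1 + (T - ln (real n))\<^sup>2)) \<le> 6 * (arctan (ln (real (Suc n)) - T) - arctan (ln (real n) - T))"
proof -
  \<comment> \<open>The function 1 / (x (1 + (ln x - T)^2)) is the derivative of arctan (ln x - T),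
    so the sum over n will telescope. Between n and n + 1 the factor x at most doubles and ln x
    grows by at most 1, which costs the factors 2 and 3.\<close>
  have "\<exists>x. real n < x \<and> x < real (Suc n) \<and> arctan (ln (real (Suc n)) - T) - arctan (ln (real n) - T) = (real (Suc n) - real n) * (inverse (1 + (ln x - T)\<^sup>2) * (1 / x))"
    by (rule MVT2) (use assms in \<open>auto intro!: derivative_eq_intros\<close>)
  then obtain x where x: "real n < x" "x < real n + 1" and eq: "arctan (ln (real (Suc n)) - T) - arctan (ln (real n) - T) = inverse (1 + (ln x - T)\<^sup>2) * (1 / x)"
    by auto
  have n1: "real n \<ge> 1" using assms by simp
  define v where "v = \<bar>T - ln (real n)\<bar>"
  have "ln x \<le> ln (2 * real n)" using x n1 by (subst ln_le_cancel_iff) auto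
  also have "\<dots> = ln 2 + ln (real n)" using n1 by (simp add: ln_mult)
  also have "\<dots> \<le> 1 + ln (real n)" using ln_2_less_1 by simp
  finally have 1: "ln x \<le> ln (real n) + 1" by simp
  have 2: "ln (real n) \<le> ln x" using x n1 by (subst ln_le_cancel_iff) auto
  have "\<bar>ln x - T\<bar> \<le> v + 1" unfolding v_def using 1 2 by linarith
  then have "\<bar>ln x - T\<bar>\<^sup>2 \<le> (v + 1)\<^sup>2" by (intro power_mono) auto
  moreover have "(v + 1)\<^sup>2 \<le> 2 * v\<^sup>2 + 2"
    using sum_squares_bound[of v 1] by (simp add: power2_eq_square algebra_simps)
  moreover have "0 \<le> v\<^sup>2" by simp
  ultimately have b: "1 + (ln x - T)\<^sup>2 \<le> 3 * (1 + v\<^sup>2)" unfolding power2_abs distrib_left by linarith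
  have xn: "x \<le> 2 * real n" using x n1 by simp
  have pos: "0 < 1 + (ln x - T)\<^sup>2" by (simp add: add_pos_nonneg)
  have "(1 + (ln x - T)\<^sup>2) * x \<le> (3 * (1 + v\<^sup>2)) * (2 * real n)"
    using b xn x n1 by (intro mult_mono) auto
  then have "1 / ((3 * (1 + v\<^sup>2)) * (2 * real n)) \<le> 1 / ((1 + (ln x - T)\<^sup>2) * x)"
    using pos x n1 by (intro divide_left_mono mult_pos_pos) (auto simp: add_pos_nonneg)
  also have "\<dots> = inverse (1 + (ln x - T)\<^sup>2) * (1 / x)" by (simp add: divide_inverse mult.commute)
  finally have step: "1 / ((3 * (1 + v\<^sup>2)) * (2 * real n)) \<le> arctan (ln (real (Suc n)) - T) - arctan (ln (real n) - T)"
    unfolding eq .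
  have six: "1 / (real n * D) = 6 * (1 / ((3 * D) * (2 * real n)))" for D by simp
  have "1 / (real n * (1 + v\<^sup>2)) \<le> 6 * (arctan (ln (real (Suc n)) - T) - arctan (ln (real n) - T))"
    unfolding six[of "1 + v\<^sup>2"] using step by (rule mult_left_mono) simp
  then show ?thesis unfolding v_def power2_abs .
qed

lemma powr_uminus_le_inverse:
  assumes "a \<ge> 1" "n > 0"
  shows "real n powr (-a) \<le> 1 / real n"
proof -
  have "real n powr (-a) \<le> real n powr (-1)"
    using assms by (intro powr_mono) auto
  then show ?thesis using assms by (simp add: powr_minus_divide)
qed

lemma cauchy_kernel_sum_bounded:
  assumes a: "a > 1"
  shows "(\<Sum>n. real n powr (-a) * (1 / (1 + (T - ln (real n))\<^sup>2))) \<le> 24"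
proof (rule suminf_le_const)
  have "\<bar>1 / (1 + (T - ln (real n))\<^sup>2)\<bar> \<le> 1" for n
    by (simp add: divide_le_eq add_pos_nonneg)
  then show "summable (\<lambda>n. real n powr (-a) * (1 / (1 + (T - ln (real n))\<^sup>2)))"
    using a by (intro weighted_summable(2)[where K = 1])
  \<comment> \<open>The summand n = 0 is 0, so the telescoping starts at ln 1.\<close>
  have *: "(\<Sum>n<Suc N. real n powr (-a) * (1 / (1 + (T - ln (real n))\<^sup>2))) \<le> 6 * (arctan (ln (real (Suc N)) - T) - arctan (ln 1 - T))" for N
  proof (induction N)
    case (Suc N)
    have "real (Suc N) powr (-a) * (1 / (1 + (T - ln (real (Suc N)))\<^sup>2)) \<le> (1 / real (Suc N)) * (1 / (1 + (T - ln (real (Suc N)))\<^sup>2))"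
      using a by (intro mult_right_mono powr_uminus_le_inverse) (auto simp: add_nonneg_nonneg)
    also have "\<dots> \<le> 6 * (arctan (ln (real (Suc (Suc N))) - T) - arctan (ln (real (Suc N)) - T))"
      using arctan_ln_step[of "Suc N" T] by simp
    finally show ?case using Suc by simp
  qed simp
  show "(\<Sum>n<N. real n powr (-a) * (1 / (1 + (T - ln (real n))\<^sup>2))) \<le> 24" for N
  proof (cases N)
    case (Suc M)
    \<comment> \<open>pi / 2 < 2, so 24 = 6 (2 + 2) serves for all T and a.\<close>
    have "arctan (ln (real (Suc M)) - T) \<le> 2" "arctan (ln 1 - T) \<ge> -2"
      using arctan_bounded[of "ln (real (Suc M)) - T"] arctan_bounded[of "ln 1 - T"] pi_less_4 by linarith+
    moreover have "6 * (x - y) \<le> 24" if "x \<le> 2" "y \<ge> -2" for x y :: real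
      using that by simp
    ultimately show ?thesis unfolding Suc using *[of M] order_trans by blast
  qed simp
qed

text \<open>The substitute for a Chebyshev bound. Comparison with the unweighted sum bounds the
  average for \<open>fejer 1\<close> by 121 = 5 * 24 + 1; the kernels centred at T and T - pi
  together dominate the Cauchy kernel, which gives 2178 = 9 * (121 + 121).\<close>

lemma mangoldt_cauchy_kernel_bounded:
  "\<exists>C T0 a0. a0 > 1 \<and> C > 0 \<and> (\<forall>T\<ge>T0. \<forall>a. 1 < a \<longrightarrow> a < a0 \<longrightarrow>
    (\<Sum>n. mangoldt n * real n powr (-a) * (1 / (1 + (T - ln (real n))\<^sup>2))) \<le> C)"
proof -
  obtain T0 a0 where a0: "a0 > 1" and cl: "\<And>T a. T \<ge> T0 \<Longrightarrow> 1 < a \<Longrightarrow> a < a0 \<Longrightarrow> 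
    \<bar>(\<Sum>n. mangoldt n * real n powr (-a) * fejer 1 (T - ln (real n))) - (\<Sum>n. real n powr (-a) * fejer 1 (T - ln (real n)))\<bar> \<le> 1"
    using fejer_average_close[of 1 1] by auto
  have cauchy1: "\<bar>1 / (1 + x\<^sup>2)\<bar> \<le> 1" for x :: real
    by (simp add: divide_le_eq add_pos_nonneg)
  have A: "(\<Sum>n. mangoldt n * real n powr (-a) * fejer 1 (T - ln (real n))) \<le> 121"
    if "T \<ge> T0" "1 < a" "a < a0" for T a
  proof -
    have "(\<Sum>n. real n powr (-a) * fejer 1 (T - ln (real n))) \<le> (\<Sum>n. 5 * (real n powr (-a) * (1 / (1 + (T - ln (real n))\<^sup>2))))"
    proof (rule suminf_le)
      show "summable (\<lambda>n. real n powr (-a) * fejer 1 (T - ln (real n)))"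
        using that(2) abs_fejer_le[of 1] by (intro weighted_summable(2)[where K = 1]) auto
      show "summable (\<lambda>n. 5 * (real n powr (-a) * (1 / (1 + (T - ln (real n))\<^sup>2))))"
        using that(2) cauchy1 by (intro summable_mult weighted_summable(2)[where K = 1])
      show "real n powr (-a) * fejer 1 (T - ln (real n)) \<le> 5 * (real n powr (-a) * (1 / (1 + (T - ln (real n))\<^sup>2)))" for n
        using mult_left_mono[OF fejer_1_le[of "T - ln (real n)"], of "real n powr (-a)"] by (simp add: mult_ac)
    qed
    also have "\<dots> = 5 * (\<Sum>n. real n powr (-a) * (1 / (1 + (T - ln (real n))\<^sup>2)))"
      using that(2) cauchy1 by (intro suminf_mult weighted_summable(2)[where K = 1])
    also have "\<dots> \<le> 120" using cauchy_kernel_sum_bounded[OF that(2), of T] by simp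
    finally show ?thesis using cl[OF that] by linarith
  qed
  have "(\<Sum>n. mangoldt n * real n powr (-a) * (1 / (1 + (T - ln (real n))\<^sup>2))) \<le> 2178"
    if T: "T \<ge> T0 + pi" and a: "1 < a" "a < a0" for T a
  proof -
    have s1: "summable (\<lambda>n. mangoldt n * real n powr (-a) * fejer 1 (S - ln (real n)))" for S
      using a(1) abs_fejer_le[of 1] by (intro weighted_summable(1)[where K = 1]) auto
    have "(\<Sum>n. mangoldt n * real n powr (-a) * (1 / (1 + (T - ln (real n))\<^sup>2)))
      \<le> (\<Sum>n. 9 * (mangoldt n * real n powr (-a) * fejer 1 (T - ln (real n)) + mangoldt n * real n powr (-a) * fejer 1 (T - pi - ln (real n))))"
    proof (rule suminf_le)
      show "summable (\<lambda>n. mangoldt n * real n powr (-a) * (1 / (1 + (T - ln (real n))\<^sup>2)))"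
        using a(1) cauchy1 by (intro weighted_summable(1)[where K = 1])
      show "summable (\<lambda>n. 9 * (mangoldt n * real n powr (-a) * fejer 1 (T - ln (real n)) + mangoldt n * real n powr (-a) * fejer 1 (T - pi - ln (real n))))"
        by (intro summable_mult summable_add s1)
      fix n
      have eq: "T - ln (real n) - pi = T - pi - ln (real n)" by simp
      have "0 \<le> (mangoldt n :: real) * real n powr (-a)" by (simp add: mangoldt_nonneg)
      from mult_left_mono[OF fejer_1_shift_ge[of "T - ln (real n)"] this]
      show "mangoldt n * real n powr (-a) * (1 / (1 + (T - ln (real n))\<^sup>2)) \<le> 9 * (mangoldt n * real n powr (-a) * fejer 1 (T - ln (real n)) + mangoldt n * real n powr (-a) * fejer 1 (T - pi - ln (real n)))"
        unfolding eq by (simp only: algebra_simps)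
    qed
    also have "\<dots> = 9 * ((\<Sum>n. mangoldt n * real n powr (-a) * fejer 1 (T - ln (real n))) + (\<Sum>n. mangoldt n * real n powr (-a) * fejer 1 (T - pi - ln (real n))))"
      unfolding suminf_add[OF s1 s1] by (intro suminf_mult summable_add s1)
    also have "\<dots> \<le> 9 * (121 + 121)"
      using A[of T a] A[of "T - pi" a] T a pi_gt_zero by (intro mult_left_mono add_mono) auto
    finally show ?thesis by simp
  qed
  then show ?thesis using a0 
    by (intro exI[of _ "2178"] exI[of _ "T0 + pi"] exI[of _ a0]) auto
qed

text \<open>Only n with T - 1 / l \<le> ln n \<le> T are used. Up to rounding there are at least exp
  T / (2 l) of them, each contributing at least exp (-T) / 2 * (l / 4), in total 1/16. The range of
  a must depend on T, since for fixed a > 1 the sum tends to 0 as T grows.\<close>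

lemma fejer_average_lower:
  assumes l: "l \<ge> 1"
  shows "\<exists>T0. \<forall>T\<ge>T0. \<exists>a0>1. \<forall>a. 1 < a \<longrightarrow> a < a0 \<longrightarrow> (\<Sum>n. real n powr (-a) * fejer l (T - ln (real n))) \<ge> 1 / 20"
proof -
  have "((\<lambda>T. l * exp (-T)) \<longlongrightarrow> 0) at_top"
    by real_asymp
  then have "eventually (\<lambda>T. l * exp (-T) < 1 / 10) at_top"
    by (rule order_tendstoD) simp
  then have "eventually (\<lambda>T::real. T > 0 \<and> l * exp (-T) \<le> 1 / 10) at_top"
    using eventually_gt_at_top[of 0] by eventually_elim auto
  then obtain T0 where T0: "\<And>T. T \<ge> T0 \<Longrightarrow> T > 0 \<and> l * exp (-T) \<le> 1 / 10"
    by (auto simp: eventually_at_top_linorder)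
  have "(\<Sum>n. real n powr (-a) * fejer l (T - ln (real n))) \<ge> 1 / 20"
    if T: "T \<ge> T0" and a: "1 < a" "a < 1 + 1 / (2 * T)" for T a
  proof -
    have Tp: "T > 0" "l * exp (-T) \<le> 1 / 10" using T0[OF T] by auto
    define N where "N = {nat \<lfloor>exp (T - 1 / l)\<rfloor> + 1..nat \<lfloor>exp T\<rfloor>}"
    have le: "exp (T - 1 / l) \<le> exp T" using l by simp
    have N: "n > 0" "exp (T - 1 / l) \<le> real n" "real n \<le> exp T" if "n \<in> N" for n
    proof -
      show "n > 0" using that by (auto simp: N_def)
      have "nat \<lfloor>exp (T - 1 / l)\<rfloor> + 1 \<le> n" "n \<le> nat \<lfloor>exp T\<rfloor>" using that by (auto simp: N_def)
      then have "\<lfloor>exp (T - 1 / l)\<rfloor> + 1 \<le> int n" "int n \<le> \<lfloor>exp T\<rfloor>" by (auto simp: nat_le_iff le_nat_iff)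
      then show "exp (T - 1 / l) \<le> real n" "real n \<le> exp T" by linarith+
    qed
    have card: "real (card N) \<ge> exp T - exp (T - 1 / l) - 1"
    proof -
      have "real (card N) \<ge> real (nat \<lfloor>exp T\<rfloor>) - real (nat \<lfloor>exp (T - 1 / l)\<rfloor>)"
      proof -
        have "nat \<lfloor>exp T\<rfloor> \<le> card N + nat \<lfloor>exp (T - 1 / l)\<rfloor>" by (simp add: N_def)
        then show ?thesis by linarith
      qed
      moreover have "real (nat \<lfloor>exp T\<rfloor>) \<ge> exp T - 1" "real (nat \<lfloor>exp (T - 1 / l)\<rfloor>) \<le> exp (T - 1 / l)"
        by (simp_all add: of_nat_nat)
      ultimately show ?thesis by linarith
    qed
    have term_ge: "exp (-T) / 2 * (l / 4) \<le> real n powr (-a) * fejer l (T - ln (real n))" if n: "n \<in> N" for n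
    proof (rule mult_mono)
      have ln: "ln (real n) \<le> T" "ln (real n) \<ge> T - 1 / l"
        using N[OF n] by (metis ln_exp ln_le_cancel_iff exp_gt_zero of_nat_0_less_iff)+
      then show "l / 4 \<le> fejer l (T - ln (real n))"
        using l by (intro fejer_ge_quarter) auto
      \<comment> \<open>Here the restriction on a enters: compared with exp (-T), the weight n^(-a)
        loses at most the factor exp (-1/2) \<ge> 1/2.\<close>
      have "(a - 1) * T \<le> (1 / (2 * T)) * T" using a Tp by (intro mult_right_mono) auto
      also have "\<dots> = 1 / 2" using Tp by simp
      finally have "a * T \<le> T + 1 / 2" by (simp add: algebra_simps)
      have "exp (-T) * (1 / 2) \<le> exp (-T) * exp (- (1 / 2))"
        using exp_ge_add_one_self[of "- (1 / 2)"] by (intro mult_left_mono) auto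
      also have "\<dots> = exp (-T - 1 / 2)" by (simp add: exp_add[symmetric])
      also have "\<dots> \<le> exp (- (a * T))" using \<open>a * T \<le> T + 1 / 2\<close> by simp
      also have "\<dots> \<le> exp (- a * ln (real n))" using ln a by simp
      also have "\<dots> = real n powr (-a)" using N[OF n] by (simp add: powr_def)
      finally show "exp (-T) / 2 \<le> real n powr (-a)" by simp
    qed (use l in auto)
    have "1 / (1 + 1 / l) \<ge> exp (- (1 / l))"
    proof -
      have "exp (1 / l) \<ge> 1 + 1 / l" by (rule exp_ge_add_one_self)
      then have "1 / exp (1 / l) \<le> 1 / (1 + 1 / l)" using l by (intro divide_left_mono) (auto simp: add_pos_pos)
      then show ?thesis by (simp add: exp_minus inverse_eq_divide)
    qed
    moreover have "1 / (1 + 1 / l) \<le> 1 - 1 / (2 * l)" using l by (simp add: field_simps)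
    ultimately have q: "1 - exp (- (1 / l)) \<ge> 1 / (2 * l)" by linarith
    \<comment> \<open>The -1 in the count costs l exp (-T) / 8 \<le> 1/80, and 1/16 - 1/80 =
      1/20.\<close>
    have "(1 / 20::real) \<le> 1 / 16 - (l * exp (-T)) / 8" using Tp by simp
    also have "\<dots> = (l / 8) * (1 / (2 * l) - exp (-T))" using l by (simp add: field_simps)
    also have "\<dots> \<le> (l / 8) * ((1 - exp (- (1 / l))) - exp (-T))" using q l by (intro mult_left_mono) auto
    also have "\<dots> = (exp T - exp (T - 1 / l) - 1) * (exp (-T) / 2 * (l / 4))"
      by (simp add: field_simps exp_minus exp_diff)
    also have "\<dots> \<le> real (card N) * (exp (-T) / 2 * (l / 4))"
      using card l by (intro mult_right_mono) auto
    also have "\<dots> = (\<Sum>n\<in>N. exp (-T) / 2 * (l / 4))" by simp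
    also have "\<dots> \<le> (\<Sum>n\<in>N. real n powr (-a) * fejer l (T - ln (real n)))"
      using term_ge by (rule sum_mono)
    also have "\<dots> \<le> (\<Sum>n. real n powr (-a) * fejer l (T - ln (real n)))"
      using a(1) l abs_fejer_le[of l] by (intro sum_le_suminf weighted_summable(2)[where K = l]) (auto simp: N_def fejer_nonneg)
    finally show ?thesis .
  qed
  note main = this
  show ?thesis
  proof (rule exI[of _ T0], intro allI impI)
    fix T assume T: "T0 \<le> T"
    then have "T > 0" using T0 by blast
    then have "1 + 1 / (2 * T) > 1" by simp
    with main[OF T] show "\<exists>a0>1. \<forall>a. 1 < a \<longrightarrow> a < a0 \<longrightarrow> (\<Sum>n. real n powr (-a) * fejer l (T - ln (real n))) \<ge> 1 / 20"
      by blast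
  qed
qed

section \<open>Primes from averages\<close>

lemma proper_prime_powers_card:
  assumes X: "X > 0"
  shows "finite {n. primepow n \<and> \<not> prime n \<and> real n \<le> exp X}"
    "real (card {n. primepow n \<and> \<not> prime n \<and> real n \<le> exp X}) \<le> exp (X / 2) * (2 * X)"
proof -
  define P where "P = {1..nat \<lfloor>exp (X / 2)\<rfloor>}"
  define K where "K = {1..nat \<lfloor>2 * X\<rfloor>}"
  have sub: "{n. primepow n \<and> \<not> prime n \<and> real n \<le> exp X} \<subseteq> (\<lambda>(p, k). p ^ k) ` (P \<times> K)"
  proof safe
    fix n :: nat assume n: "primepow n" "\<not> prime n" "real n \<le> exp X"
    then obtain p k where pk: "prime p" "k > 0" "n = p ^ k"
      by (auto simp: primepow_def)
    have k2: "k \<ge> 2" using pk n(2) by (cases "k = 1") auto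
    have p1: "p \<ge> 2" using pk(1) by (rule prime_ge_2_nat)
    \<comment> \<open>An exponent k \<ge> 2 forces p \<le> exp (X / 2), while p \<ge> 2 forces k ln
      2 \<le> X and so k \<le> 2 X.\<close>
    have "real p ^ 2 \<le> real p ^ k" using k2 p1 by (intro power_increasing) auto
    also have "\<dots> \<le> exp X" using n(3) pk(3) by simp
    also have "\<dots> = exp (X / 2) ^ 2" by (simp add: power2_eq_square exp_add[symmetric])
    finally have "real p \<le> exp (X / 2)" by (rule power2_le_imp_le) simp
    then have pP: "p \<in> P" using p1 by (auto simp: P_def le_nat_iff le_floor_iff)
    have "real k * ln 2 \<le> real k * ln (real p)" using p1 by (intro mult_left_mono) auto
    also have "\<dots> = ln (real n)" using p1 pk(3) by (simp add: ln_realpow)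
    also have "\<dots> \<le> ln (exp X)" using n(3) pk p1 by (subst ln_le_cancel_iff) auto
    finally have "real k * ln 2 \<le> X" by simp
    moreover have "real k * (1 / 2) \<le> real k * ln 2" using ln2_ge_two_thirds by (intro mult_left_mono) auto
    ultimately have "real k \<le> 2 * X" by linarith
    then have "k \<in> K" using k2 by (auto simp: K_def le_nat_iff le_floor_iff)
    with pP show "n \<in> (\<lambda>(p, k). p ^ k) ` (P \<times> K)" using pk(3) by force
  qed
  have fin: "finite (P \<times> K)" by (simp add: P_def K_def)
  show "finite {n. primepow n \<and> \<not> prime n \<and> real n \<le> exp X}"
    using sub fin by (meson finite_imageI finite_subset)
  have "card {n. primepow n \<and> \<not> prime n \<and> real n \<le> exp X} \<le> card (P \<times> K)"
    using surj_card_le[OF fin sub] .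
  also have "\<dots> = nat \<lfloor>exp (X / 2)\<rfloor> * nat \<lfloor>2 * X\<rfloor>"
    by (simp add: P_def K_def)
  finally have "real (card {n. primepow n \<and> \<not> prime n \<and> real n \<le> exp X}) \<le> real (nat \<lfloor>exp (X / 2)\<rfloor>) * real (nat \<lfloor>2 * X\<rfloor>)"
    unfolding of_nat_mult[symmetric] by (rule of_nat_mono)
  also have "\<dots> \<le> exp (X / 2) * (2 * X)"
    using X by (intro mult_mono) (auto simp: of_nat_nat)
  finally show "real (card {n. primepow n \<and> \<not> prime n \<and> real n \<le> exp X}) \<le> exp (X / 2) * (2 * X)" .
qed

text \<open>Without a prime in the window, the average of \<Lambda> consists of the tail outside, at
  most 1/100 for large l, and of proper prime powers inside, at most 1/100 for large T. By
  comparison with the unweighted sum it is at least 1/20 - 1/100.\<close>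

theorem prime_in_log_window:
  assumes d: "d > 0"
  shows "\<exists>T0. \<forall>T\<ge>T0. \<exists>p::nat. prime p \<and> \<bar>T - ln (real p)\<bar> \<le> d"
proof -
  obtain C T1 a1 where C: "C > 0" and a1: "a1 > 1" and bounded: "\<And>T a. T \<ge> T1 \<Longrightarrow> 1 < a \<Longrightarrow> a < a1 \<Longrightarrow>
    (\<Sum>n. mangoldt n * real n powr (-a) * (1 / (1 + (T - ln (real n))\<^sup>2))) \<le> C"
    using mangoldt_cauchy_kernel_bounded by blast
  \<comment> \<open>For |v| > d one has 1 + v^2 \<le> (1 + 1 / d^2) v^2, so outside the window the
    kernel is at most B / l times the Cauchy kernel. As \<open>C\<close> is independent of l, l may
    be chosen in terms of it.\<close>
  define B where "B = 4 * (1 + 1 / d\<^sup>2)"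
  have B: "B > 0" using d by (simp add: B_def add_pos_pos)
  define l where "l = max 1 (100 * (B * C))"
  have l: "l \<ge> 1" "l > 0" by (auto simp: l_def)
  have lB: "B / l * C \<le> 1 / 100"
  proof -
    have "100 * (B * C) \<le> l" by (simp add: l_def)
    then show ?thesis using l by (simp add: field_simps)
  qed
  obtain T2 a2 where a2: "a2 > 1" and close: "\<And>T a. T \<ge> T2 \<Longrightarrow> 1 < a \<Longrightarrow> a < a2 \<Longrightarrow>
    \<bar>(\<Sum>n. mangoldt n * real n powr (-a) * fejer l (T - ln (real n))) - (\<Sum>n. real n powr (-a) * fejer l (T - ln (real n)))\<bar> \<le> 1 / 100"
    using fejer_average_close[of l "1 / 100"] l by auto
  obtain T3 where lower: "\<And>T. T \<ge> T3 \<Longrightarrow> \<exists>a0>1. \<forall>a. 1 < a \<longrightarrow> a < a0 \<longrightarrow> (\<Sum>n. real n powr (-a) * fejer l (T - ln (real n))) \<ge> 1 / 20"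
    using fejer_average_lower[OF l(1)] by blast
  \<comment> \<open>Number of proper prime powers up to exp (T + d) times the largest weight one of
    them has in the window; the growth exp (T / 2) of the number loses against exp (-T).\<close>
  have "((\<lambda>T. l * ((exp ((T + d) / 2) * (2 * (T + d))) * ((T + d) * exp (d - T)))) \<longlongrightarrow> 0) at_top"
    by real_asymp
  then have "eventually (\<lambda>T. l * ((exp ((T + d) / 2) * (2 * (T + d))) * ((T + d) * exp (d - T))) < 1 / 100) at_top"
    by (rule order_tendstoD) simp
  then obtain T4 where T4: "\<And>T. T \<ge> T4 \<Longrightarrow> l * ((exp ((T + d) / 2) * (2 * (T + d))) * ((T + d) * exp (d - T))) < 1 / 100"
    by (auto simp: eventually_at_top_linorder)
  have "\<exists>p::nat. prime p \<and> \<bar>T - ln (real p)\<bar> \<le> d" if T: "T \<ge> Max {T1, T2, T3, T4, d}" for T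
  proof (rule ccontr)
    assume "\<not> ?thesis"
    then have no_prime: "\<not> prime p" if "\<bar>T - ln (real p)\<bar> \<le> d" for p :: nat using that by blast
    have Ts: "T \<ge> T1" "T \<ge> T2" "T \<ge> T3" "T \<ge> T4" "T \<ge> d" using T by auto
    obtain a0 where a0: "a0 > 1" and low: "\<And>a. 1 < a \<Longrightarrow> a < a0 \<Longrightarrow> (\<Sum>n. real n powr (-a) * fejer l (T - ln (real n))) \<ge> 1 / 20"
      using lower[OF Ts(3)] by blast
    define m where "m = min a0 (min a1 a2)"
    have "1 < m" using a0 a1 a2 by (simp add: m_def)
    then obtain a where a: "1 < a" "a < m" using dense by blast
    then have a: "1 < a" "a < a0" "a < a1" "a < a2" by (auto simp: m_def)
    define W where "W = {n. primepow n \<and> \<not> prime n \<and> real n \<le> exp (T + d) \<and> \<bar>T - ln (real n)\<bar> \<le> d}"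
    have Td: "T + d > 0" using Ts(5) d by simp
    have Wsub: "W \<subseteq> {n. primepow n \<and> \<not> prime n \<and> real n \<le> exp (T + d)}" by (auto simp: W_def)
    have finW: "finite W" using Wsub proper_prime_powers_card(1)[OF Td] finite_subset by blast
    have "card W \<le> card {n. primepow n \<and> \<not> prime n \<and> real n \<le> exp (T + d)}"
      by (rule card_mono[OF proper_prime_powers_card(1)[OF Td] Wsub])
    then have cardW: "real (card W) \<le> exp ((T + d) / 2) * (2 * (T + d))"
      using proper_prime_powers_card(2)[OF Td] by linarith
    \<comment> \<open>Inside the window the kernel is replaced by its maximum l; only proper prime
      powers occur there.\<close>
    define h where "h = (\<lambda>n. if n \<in> W then l * (mangoldt n * real n powr (-a)) else 0)"
    have hW: "h sums (\<Sum>n\<in>W. l * (mangoldt n * real n powr (-a)))"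
      unfolding h_def by (rule sums_If_finite_set[OF finW])
    have "(\<Sum>n\<in>W. l * (mangoldt n * real n powr (-a))) \<le> (\<Sum>n\<in>W. l * ((T + d) * exp (d - T)))"
    proof (intro sum_mono mult_left_mono mult_mono)
      fix n assume n: "n \<in> W"
      then have n0: "n > 0" using primepow_gt_0_nat by (auto simp: W_def)
      have ln: "ln (real n) \<le> T + d" "ln (real n) \<ge> T - d" using n by (auto simp: W_def)
      show "mangoldt n \<le> T + d" using mangoldt_le_ln'[of n] ln by linarith
      have "real n powr (-a) \<le> 1 / real n" using a n0 by (intro powr_uminus_le_inverse) auto
      also have "\<dots> = exp (- ln (real n))" using n0 by (simp add: exp_minus inverse_eq_divide)
      also have "\<dots> \<le> exp (d - T)" using ln by simp
      finally show "real n powr (-a) \<le> exp (d - T)" .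
    qed (use l Td in auto)
    also have "\<dots> = l * (real (card W) * ((T + d) * exp (d - T)))" by simp
    also have "\<dots> \<le> l * ((exp ((T + d) / 2) * (2 * (T + d))) * ((T + d) * exp (d - T)))"
      using cardW l Td by (intro mult_left_mono mult_right_mono) auto
    also have "\<dots> \<le> 1 / 100" using T4[OF Ts(4)] by simp
    finally have hsum: "suminf h \<le> 1 / 100" using hW by (simp add: sums_iff)
    have cauchy1: "\<bar>1 / (1 + x\<^sup>2)\<bar> \<le> 1" for x :: real
      by (simp add: divide_le_eq add_pos_nonneg)
    have sc: "summable (\<lambda>n. mangoldt n * real n powr (-a) * (1 / (1 + (T - ln (real n))\<^sup>2)))"
      using a(1) cauchy1 by (intro weighted_summable(1)[where K = 1])
    have "(\<Sum>n. mangoldt n * real n powr (-a) * fejer l (T - ln (real n))) \<le>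
      (\<Sum>n. B / l * (mangoldt n * real n powr (-a) * (1 / (1 + (T - ln (real n))\<^sup>2))) + h n)"
    proof (rule suminf_le)
      show "summable (\<lambda>n. mangoldt n * real n powr (-a) * fejer l (T - ln (real n)))"
        using a(1) abs_fejer_le[OF l(2)] by (intro weighted_summable(1)[where K = l])
      show "summable (\<lambda>n. B / l * (mangoldt n * real n powr (-a) * (1 / (1 + (T - ln (real n))\<^sup>2))) + h n)"
        using hW by (intro summable_add summable_mult sc) (simp add: sums_iff)
      fix n
      define v where "v = T - ln (real n)"
      define w where "w = (mangoldt n :: real) * real n powr (-a)"
      have w: "w \<ge> 0" by (simp add: w_def mangoldt_nonneg)
      have k0: "0 \<le> B / l * (w * (1 / (1 + v\<^sup>2)))" using B l w by (simp add: add_nonneg_nonneg)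
      have h0: "h n \<ge> 0" using l w by (simp add: h_def w_def)
      show "mangoldt n * real n powr (-a) * fejer l (T - ln (real n)) \<le> B / l * (mangoldt n * real n powr (-a) * (1 / (1 + (T - ln (real n))\<^sup>2))) + h n"
        unfolding v_def[symmetric] w_def[symmetric]
      proof (cases "\<bar>v\<bar> \<le> d")
        case True
        show "w * fejer l v \<le> B / l * (w * (1 / (1 + v\<^sup>2))) + h n"
        proof (cases "primepow n")
          case pp: True
          have n0: "real n > 0" using pp primepow_gt_0_nat by auto
          have "ln (real n) \<le> T + d" using True by (auto simp: v_def)
          then have "exp (ln (real n)) \<le> exp (T + d)" by simp
          then have "n \<in> W" using pp True no_prime[of n] n0 by (auto simp: W_def v_def)
          then have "h n = l * w" by (simp add: h_def w_def)
          moreover have "w * fejer l v \<le> w * l" using w fejer_le[OF l(2)] by (intro mult_left_mono)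
          ultimately show ?thesis using k0 by (simp add: mult.commute)
        next
          case False
          then have "w = 0" by (simp add: w_def mangoldt_def)
          then show ?thesis using h0 by simp
        qed
      next
        case False
        then have v0: "v \<noteq> 0" and vd: "d\<^sup>2 \<le> v\<^sup>2" using d by (auto intro: power_mono simp: abs_le_square_iff[symmetric])
        have v2: "v\<^sup>2 > 0" using v0 by simp
        have "1 + v\<^sup>2 \<le> (1 + 1 / d\<^sup>2) * v\<^sup>2"
          using vd d by (simp add: field_simps)
        then have "4 * (1 + v\<^sup>2) \<le> B * v\<^sup>2"
          unfolding B_def mult.assoc[of 4] by (rule mult_left_mono) simp
        then have "4 / (l * v\<^sup>2) \<le> B / l * (1 / (1 + v\<^sup>2))"
          using l v2 by (simp add: divide_le_eq pos_le_divide_eq add_pos_nonneg mult_ac)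
        with fejer_le_square[OF l(2) v0] have "fejer l v \<le> B / l * (1 / (1 + v\<^sup>2))" by linarith
        from mult_left_mono[OF this w] h0 show "w * fejer l v \<le> B / l * (w * (1 / (1 + v\<^sup>2))) + h n"
          by (simp add: mult_ac)
      qed
    qed
    also have "\<dots> = B / l * (\<Sum>n. mangoldt n * real n powr (-a) * (1 / (1 + (T - ln (real n))\<^sup>2))) + suminf h"
      using suminf_add[OF summable_mult[OF sc, of "B / l"], of h] suminf_mult[OF sc, of "B / l"] hW by (simp add: sums_iff)
    also have "\<dots> \<le> B / l * C + 1 / 100"
      using bounded[OF Ts(1) a(1,3)] hsum B l by (intro add_mono mult_left_mono) auto
    also have "\<dots> \<le> 2 / 100" using lB by linarith
    finally show False
      using close[OF Ts(2) a(1,4)] low[OF a(1,2)] by linarith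
  qed
  then show ?thesis by blast
qed

corollary prime_in_short_interval:
  assumes e: "0 < e" "e < 1"
  shows "\<exists>x0. \<forall>x\<ge>x0. \<exists>p::nat. prime p \<and> (1 - e) * x \<le> real p \<and> real p \<le> x"
proof -
  \<comment> \<open>The window of half-width d around ln x - d is [ln x - 2 d, ln x], which equals
    [ln ((1 - e) x), ln x].\<close>
  define d where "d = - ln (1 - e) / 2"
  have d: "d > 0" using e by (simp add: d_def)
  obtain T0 where T0: "\<And>T. T \<ge> T0 \<Longrightarrow> \<exists>p::nat. prime p \<and> \<bar>T - ln (real p)\<bar> \<le> d"
    using prime_in_log_window[OF d] by blast
  have "\<exists>p::nat. prime p \<and> (1 - e) * x \<le> real p \<and> real p \<le> x" if x: "x \<ge> exp (T0 + d)" for x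
  proof -
    have x0: "x > 0" using x by (rule less_le_trans[OF exp_gt_zero])
    have "ln (exp (T0 + d)) \<le> ln x" using x x0 by (subst ln_le_cancel_iff) auto
    then have "ln x - d \<ge> T0" by simp
    then obtain p :: nat where p: "prime p" "\<bar>(ln x - d) - ln (real p)\<bar> \<le> d" using T0 by blast
    have p0: "real p > 0" using p(1) prime_gt_0_nat by simp
    have "ln (real p) \<le> ln x" using p(2) by linarith
    then have "real p \<le> x" using p0 x0 by simp
    have "ln ((1 - e) * x) = ln x - 2 * d" using e x0 by (simp add: ln_mult d_def)
    then have "ln ((1 - e) * x) \<le> ln (real p)" using p(2) by linarith
    then have "(1 - e) * x \<le> real p" using p0 x0 e by simp
    with \<open>real p \<le> x\<close> p(1) show ?thesis by blast
  qed
  then show ?thesis by blast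
qed

section \<open>Sets with few representations\<close>

text \<open>
  Number the four pieces of the set \<open>dense_set\<close> below from left to right. Then \<open>cij\<close> stands for the number
  of representations of \<open>k\<close> as a sum of an element of piece \<open>i\<close> and one of piece \<open>j\<close>. The second
  piece has difference 2, so its bounds are stated for twice the count to avoid rounding.
\<close>

lemma four_piece_arith:
  fixes G t u k c11 c22 c33 c44 c12 c13 c14 c23 c24 c34 :: int
  assumes "3 * t \<le> G" "G \<le> 3 * t + 2" "2 * u \<le> t" "t \<le> 2 * u + 1" "u \<ge> 0" 
   "c11 \<le> 0 \<or> (c11 \<le> t \<and> c11 \<le> k + 1 \<and> c11 \<le> 2 * t - 1 - k)"
   "c33 \<le> 0 \<or> (c33 \<le> t \<and> c33 \<le> k - 2 * G + 1 \<and> c33 \<le> 2 * G + 2 * t - 1 - k)"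
   "c44 \<le> 0 \<or> (c44 \<le> G \<and> c44 \<le> k - 4 * G + 2 * t - 1 \<and> c44 \<le> 6 * G - 2 * t + 1 - k)"
   "c13 \<le> 0 \<or> (c13 \<le> t \<and> c13 \<le> k - G + 1 \<and> c13 \<le> G + 2 * t - 1 - k)"
   "c14 \<le> 0 \<or> (c14 \<le> t \<and> c14 \<le> k - 2 * G + t \<and> c14 \<le> 3 * G - k)"
   "c34 \<le> 0 \<or> (c34 \<le> t \<and> c34 \<le> k - 3 * G + t \<and> c34 \<le> 4 * G - k)"
   "c22 \<le> 0 \<or> (2 * c22 \<le> 2 * u \<and> 2 * c22 \<le> k - 2 * G + 2 * t + 2 \<and> 2 * c22 \<le> 4 * u - 2 - k + 2 * G - 2 * t)"
   "c12 \<le> 0 \<or> (2 * c12 \<le> 2 * u \<and> 2 * c12 \<le> t + 1 \<and> 2 * c12 \<le> k - G + t + 2 \<and> 2 * c12 \<le> 2 * u + G - 1 - k)"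
   "c23 \<le> 0 \<or> (2 * c23 \<le> 2 * u \<and> 2 * c23 \<le> t + 1 \<and> 2 * c23 \<le> k - 2 * G + t + 2 \<and> 2 * c23 \<le> 2 * u + 2 * G - 1 - k)"
   "c24 \<le> 0 \<or> (2 * c24 \<le> 2 * u \<and> 2 * c24 \<le> G + 1 \<and> 2 * c24 \<le> k - 3 * G + 2 * t + 1 \<and> 2 * c24 \<le> 2 * u + 4 * G - 2 * t - k)"
  shows "c11 + c22 + c33 + c44 + 2 * c12 + 2 * c13 + 2 * c14 + 2 * c23 + 2 * c24 + 2 * c34 \<le> G"
  using assms by (smt (z3))

section \<open>Counting sums across two pieces\<close>

definition cross_count :: "int set \<Rightarrow> int set \<Rightarrow> int \<Rightarrow> int" where
  "cross_count X Y k = int (card {x \<in> X. k - x \<in> Y})"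

lemma cross_count_commute: "cross_count X Y k = cross_count Y X k"
proof -
  have "bij_betw (\<lambda>x. k - x) {x \<in> X. k - x \<in> Y} {y \<in> Y. k - y \<in> X}"
    by (rule bij_betwI[where g = "\<lambda>x. k - x"]) auto
  then have "card {x \<in> X. k - x \<in> Y} = card {y \<in> Y. k - y \<in> X}"
    by (rule bij_betw_same_card)
  then show ?thesis by (simp only: cross_count_def)
qed

lemma rep_count_eq_cross_count: "int (rep_count S k) = cross_count S S k"
proof -
  have "bij_betw (\<lambda>x. (x, k - x)) {x \<in> S. k - x \<in> S} {(s1, s2). s1 \<in> S \<and> s2 \<in> S \<and> s1 + s2 = k}"
    by (rule bij_betwI[where g = fst]) auto
  from bij_betw_same_card[OF this] show ?thesis by (simp only: cross_count_def rep_count_def)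
qed

lemma cross_count_Un_left:
  assumes "finite X" "finite X'"
  shows "cross_count (X \<union> X') Y k \<le> cross_count X Y k + cross_count X' Y k"
proof -
  have "{x \<in> X \<union> X'. k - x \<in> Y} = {x \<in> X. k - x \<in> Y} \<union> {x \<in> X'. k - x \<in> Y}" by auto
  then have "card {x \<in> X \<union> X'. k - x \<in> Y} \<le> card {x \<in> X. k - x \<in> Y} + card {x \<in> X'. k - x \<in> Y}"
    by (simp only: card_Un_le)
  then show ?thesis by (simp add: cross_count_def)
qed

text \<open>For a set cut out by linear inequalities, membership of its two extreme elements turns
  every bound on the cardinality into linear arithmetic.\<close>

lemma card_int_set_le:
  fixes J :: "int set"
  assumes "finite J" "J \<noteq> {}"
  obtains i j where "i \<in> J" "j \<in> J" "int (card J) \<le> j - i + 1"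
proof
  show "Min J \<in> J" "Max J \<in> J" using assms by auto
  have "J \<subseteq> {Min J..Max J}" using assms by auto
  then have "card J \<le> card {Min J..Max J}" by (intro card_mono) auto
  moreover have "Min J \<le> Max J" using assms by simp
  ultimately show "int (card J) \<le> Max J - Min J + 1" by simp
qed

text \<open>The first alternative is the case without solutions, where the linear bounds may be
  negative; the count is an integer so that it can be compared with them.\<close>

lemma cross_count_interval_interval:
  "cross_count {a..<a + l} {b..<b + m} k \<le> 0 \<or>
    (cross_count {a..<a + l} {b..<b + m} k \<le> l \<and> cross_count {a..<a + l} {b..<b + m} k \<le> m \<and>
     cross_count {a..<a + l} {b..<b + m} k \<le> k - a - b + 1 \<and>
     cross_count {a..<a + l} {b..<b + m} k \<le> a + b + l + m - 1 - k)"
proof (cases "{x \<in> {a..<a + l}. k - x \<in> {b..<b + m}} = {}")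
  case False
  have fin: "finite {x \<in> {a..<a + l}. k - x \<in> {b..<b + m}}" by (rule finite_subset[of _ "{a..<a + l}"]) auto
  obtain i j where "i \<in> {x \<in> {a..<a + l}. k - x \<in> {b..<b + m}}" "j \<in> {x \<in> {a..<a + l}. k - x \<in> {b..<b + m}}"
    "int (card {x \<in> {a..<a + l}. k - x \<in> {b..<b + m}}) \<le> j - i + 1"
    using card_int_set_le[OF fin False] .
  then show ?thesis unfolding cross_count_def by simp
qed (simp only: cross_count_def, simp)

definition spaced :: "int \<Rightarrow> int \<Rightarrow> int set" where
  "spaced d u = (\<lambda>i. d + 2 * i) ` {0..<u}"

lemma finite_spaced [simp]: "finite (spaced d u)"
  by (simp add: spaced_def)

lemma card_spaced: "card (spaced d u) = nat u"
  unfolding spaced_def by (subst card_image) (auto simp: inj_on_def)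

lemma cross_count_spaced:
  "cross_count (spaced d u) Y k = int (card {i \<in> {0..<u}. k - d - 2 * i \<in> Y})"
proof -
  have "bij_betw (\<lambda>i. d + 2 * i) {i \<in> {0..<u}. k - d - 2 * i \<in> Y} {x \<in> spaced d u. k - x \<in> Y}"
    unfolding bij_betw_def by (auto simp: inj_on_def spaced_def image_iff algebra_simps)
  then have "card {i \<in> {0..<u}. k - d - 2 * i \<in> Y} = card {x \<in> spaced d u. k - x \<in> Y}"
    by (rule bij_betw_same_card)
  then show ?thesis by (simp only: cross_count_def)
qed

lemma cross_count_spaced_interval:
  "cross_count (spaced d u) {b..<b + m} k \<le> 0 \<or>
    (2 * cross_count (spaced d u) {b..<b + m} k \<le> 2 * u \<and> 2 * cross_count (spaced d u) {b..<b + m} k \<le> m + 1 \<and>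
     2 * cross_count (spaced d u) {b..<b + m} k \<le> k - d - b + 2 \<and>
     2 * cross_count (spaced d u) {b..<b + m} k \<le> 2 * u + b + m - 1 - (k - d))"
proof (cases "{i \<in> {0..<u}. k - d - 2 * i \<in> {b..<b + m}} = {}")
  case False
  have fin: "finite {i \<in> {0..<u}. k - d - 2 * i \<in> {b..<b + m}}" by (rule finite_subset[of _ "{0..<u}"]) auto
  obtain i j where "i \<in> {i \<in> {0..<u}. k - d - 2 * i \<in> {b..<b + m}}" "j \<in> {i \<in> {0..<u}. k - d - 2 * i \<in> {b..<b + m}}"
    "int (card {i \<in> {0..<u}. k - d - 2 * i \<in> {b..<b + m}}) \<le> j - i + 1"
    using card_int_set_le[OF fin False] .
  then show ?thesis unfolding cross_count_spaced by simp
qed (simp only: cross_count_spaced, simp)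

lemma cross_count_spaced_spaced:
  "cross_count (spaced d u) (spaced d u) k \<le> 0 \<or>
    (2 * cross_count (spaced d u) (spaced d u) k \<le> 2 * u \<and> 2 * cross_count (spaced d u) (spaced d u) k \<le> k - 2 * d + 2 \<and>
     2 * cross_count (spaced d u) (spaced d u) k \<le> 4 * u - 2 - k + 2 * d)"
proof (cases "{i \<in> {0..<u}. k - d - 2 * i \<in> spaced d u} = {}")
  case False
  have fin: "finite {i \<in> {0..<u}. k - d - 2 * i \<in> spaced d u}" by (rule finite_subset[of _ "{0..<u}"]) auto
  obtain i j where "i \<in> {i \<in> {0..<u}. k - d - 2 * i \<in> spaced d u}" "j \<in> {i \<in> {0..<u}. k - d - 2 * i \<in> spaced d u}"
    "int (card {i \<in> {0..<u}. k - d - 2 * i \<in> spaced d u}) \<le> j - i + 1"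
    using card_int_set_le[OF fin False] .
  then show ?thesis unfolding cross_count_spaced by (auto simp: spaced_def)
qed (simp only: cross_count_spaced, simp)

text \<open>Divided by g and up to rounding, the pieces are [0, 1/3], [2/3, 1] with density 1/2,
  [1, 4/3] and [5/3, 8/3]. Their self-convolution is constantly 1 on [2, 11/3] and at most 1
  elsewhere. Mass 11/6 and length 8/3 give (11/6) / sqrt (8/3) = 11 / sqrt 96.\<close>

definition dense_set :: "nat \<Rightarrow> int set" where
  "dense_set g = (let G = int g; t = G div 3; u = G div 6 in
     {0..<t} \<union> spaced (G - t) u \<union> {G..<G + t} \<union> {2 * G - t + 1..<3 * G - t + 1})"

lemma finite_dense_set [simp]: "finite (dense_set g)"
  by (simp add: dense_set_def Let_def)

lemma dense_set_subset: "dense_set g \<subseteq> {0..3 * int g - int (g div 3)}"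
proof -
  define G where "G = int g"
  have "3 * (G div 3) \<le> G" "2 * (G div 6) \<le> G div 3" "0 \<le> G" "0 \<le> G div 3" "int (g div 3) = G div 3"
    unfolding G_def by (auto simp: zdiv_int)
  then show ?thesis unfolding dense_set_def Let_def spaced_def G_def[symmetric] by auto
qed

lemma card_dense_set: "card (dense_set g) = g + 2 * (g div 3) + g div 6"
proof -
  define G where "G = int g"
  define t where "t = G div 3"
  define u where "u = G div 6"
  have h: "3 * t \<le> G" "2 * u \<le> t" "0 \<le> G" "0 \<le> t" "0 \<le> u"
    unfolding G_def t_def u_def by auto
  have "card ({0..<t} \<union> spaced (G - t) u \<union> {G..<G + t} \<union> {2 * G - t + 1..<3 * G - t + 1})
    = card ({0..<t} \<union> spaced (G - t) u \<union> {G..<G + t}) + card {2 * G - t + 1..<3 * G - t + 1}"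
    by (rule card_Un_disjoint) (use h in \<open>auto simp: spaced_def\<close>)
  also have "card ({0..<t} \<union> spaced (G - t) u \<union> {G..<G + t}) = card ({0..<t} \<union> spaced (G - t) u) + card {G..<G + t}"
    by (rule card_Un_disjoint) (use h in \<open>auto simp: spaced_def\<close>)
  also have "card ({0..<t} \<union> spaced (G - t) u) = card {0..<t} + card (spaced (G - t) u)"
    by (rule card_Un_disjoint) (use h in \<open>auto simp: spaced_def\<close>)
  finally have "card (dense_set g) = nat t + nat u + nat t + nat G"
    unfolding dense_set_def Let_def G_def[symmetric] t_def[symmetric] u_def[symmetric] card_spaced by simp
  moreover have "t = int (g div 3)" "u = int (g div 6)" by (auto simp: t_def u_def G_def zdiv_int)
  ultimately show ?thesis by (simp add: G_def)
qed

text \<open>The count is subadditive in both sets and symmetric, so it splits into four diagonal and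
  six doubled mixed counts. \<open>X2\<close> stands first in its mixed counts, as in the estimate
  for a spaced set and an interval.\<close>

lemma rep_count_dense_set: "rep_count (dense_set g) k \<le> g"
proof -
  define G where "G = int g"
  define t where "t = G div 3"
  define u where "u = G div 6"
  define X1 where "X1 = {0..<0 + t}"
  define X2 where "X2 = spaced (G - t) u"
  define X3 where "X3 = {G..<G + t}"
  define X4 where "X4 = {2 * G - t + 1..<(2 * G - t + 1) + G}"
  have A: "dense_set g = X1 \<union> X2 \<union> X3 \<union> X4"
  proof -
    have e: "(2 * G - t + 1) + G = 3 * G - t + 1" by simp
    show ?thesis
      unfolding X1_def X2_def X3_def X4_def e unfolding dense_set_def Let_def by (simp add: G_def t_def u_def)
  qed
  have fin: "finite X1" "finite X2" "finite X3" "finite X4"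
    by (simp_all add: X1_def X2_def X3_def X4_def)
  have left: "cross_count (dense_set g) Y k \<le> cross_count X1 Y k + cross_count X2 Y k + cross_count X3 Y k + cross_count X4 Y k" for Y
    unfolding A using cross_count_Un_left[of "X1 \<union> X2 \<union> X3" X4 Y k] cross_count_Un_left[of "X1 \<union> X2" X3 Y k] cross_count_Un_left[of X1 X2 Y k] fin by simp
  have right: "cross_count X (dense_set g) k \<le> cross_count X X1 k + cross_count X X2 k + cross_count X X3 k + cross_count X X4 k" for X
    using left[of X] by (simp add: cross_count_commute)
  note c = cross_count_commute[where k = k]
  have "int (rep_count (dense_set g) k) \<le> cross_count X1 X1 k + cross_count X2 X2 k + cross_count X3 X3 k + cross_count X4 X4 k
    + 2 * cross_count X2 X1 k + 2 * cross_count X1 X3 k + 2 * cross_count X1 X4 k + 2 * cross_count X2 X3 k + 2 * cross_count X2 X4 k + 2 * cross_count X3 X4 k"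
    unfolding rep_count_eq_cross_count
    using left[of "dense_set g"] right[of X1] right[of X2] right[of X3] right[of X4] 
      c[of X1 X2] c[of X3 X1] c[of X4 X1] c[of X3 X2] c[of X4 X2] c[of X4 X3] by linarith
  also have "\<dots> \<le> G"
  proof (rule four_piece_arith[of t G u _ k])
    show "3 * t \<le> G" "G \<le> 3 * t + 2" "2 * u \<le> t" "t \<le> 2 * u + 1" "u \<ge> 0"
      unfolding t_def u_def G_def by linarith+
    show "cross_count X1 X1 k \<le> 0 \<or> (cross_count X1 X1 k \<le> t \<and> cross_count X1 X1 k \<le> k + 1 \<and> cross_count X1 X1 k \<le> 2 * t - 1 - k)"
      using cross_count_interval_interval[of 0 t 0 t k] unfolding X1_def[symmetric] by auto
    show "cross_count X3 X3 k \<le> 0 \<or> (cross_count X3 X3 k \<le> t \<and> cross_count X3 X3 k \<le> k - 2 * G + 1 \<and> cross_count X3 X3 k \<le> 2 * G + 2 * t - 1 - k)"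
      using cross_count_interval_interval[of G t G t k] unfolding X3_def[symmetric] by auto
    show "cross_count X4 X4 k \<le> 0 \<or> (cross_count X4 X4 k \<le> G \<and> cross_count X4 X4 k \<le> k - 4 * G + 2 * t - 1 \<and> cross_count X4 X4 k \<le> 6 * G - 2 * t + 1 - k)"
      using cross_count_interval_interval[of "2 * G - t + 1" G "2 * G - t + 1" G k] unfolding X4_def[symmetric] by auto
    show "cross_count X1 X3 k \<le> 0 \<or> (cross_count X1 X3 k \<le> t \<and> cross_count X1 X3 k \<le> k - G + 1 \<and> cross_count X1 X3 k \<le> G + 2 * t - 1 - k)"
      using cross_count_interval_interval[of 0 t G t k] unfolding X1_def[symmetric] X3_def[symmetric] by auto
    show "cross_count X1 X4 k \<le> 0 \<or> (cross_count X1 X4 k \<le> t \<and> cross_count X1 X4 k \<le> k - 2 * G + t \<and> cross_count X1 X4 k \<le> 3 * G - k)"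
      using cross_count_interval_interval[of 0 t "2 * G - t + 1" G k] unfolding X1_def[symmetric] X4_def[symmetric] by auto
    show "cross_count X3 X4 k \<le> 0 \<or> (cross_count X3 X4 k \<le> t \<and> cross_count X3 X4 k \<le> k - 3 * G + t \<and> cross_count X3 X4 k \<le> 4 * G - k)"
      using cross_count_interval_interval[of G t "2 * G - t + 1" G k] unfolding X3_def[symmetric] X4_def[symmetric] by auto
    show "cross_count X2 X2 k \<le> 0 \<or> (2 * cross_count X2 X2 k \<le> 2 * u \<and> 2 * cross_count X2 X2 k \<le> k - 2 * G + 2 * t + 2 \<and> 2 * cross_count X2 X2 k \<le> 4 * u - 2 - k + 2 * G - 2 * t)"
      using cross_count_spaced_spaced[of "G - t" u k] unfolding X2_def[symmetric] by auto
    show "cross_count X2 X1 k \<le> 0 \<or> (2 * cross_count X2 X1 k \<le> 2 * u \<and> 2 * cross_count X2 X1 k \<le> t + 1 \<and> 2 * cross_count X2 X1 k \<le> k - G + t + 2 \<and> 2 * cross_count X2 X1 k \<le> 2 * u + G - 1 - k)"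
      using cross_count_spaced_interval[of "G - t" u 0 t k] unfolding X1_def[symmetric] X2_def[symmetric] by auto
    show "cross_count X2 X3 k \<le> 0 \<or> (2 * cross_count X2 X3 k \<le> 2 * u \<and> 2 * cross_count X2 X3 k \<le> t + 1 \<and> 2 * cross_count X2 X3 k \<le> k - 2 * G + t + 2 \<and> 2 * cross_count X2 X3 k \<le> 2 * u + 2 * G - 1 - k)"
      using cross_count_spaced_interval[of "G - t" u G t k] unfolding X2_def[symmetric] X3_def[symmetric] by auto
    show "cross_count X2 X4 k \<le> 0 \<or> (2 * cross_count X2 X4 k \<le> 2 * u \<and> 2 * cross_count X2 X4 k \<le> G + 1 \<and> 2 * cross_count X2 X4 k \<le> k - 3 * G + 2 * t + 1 \<and> 2 * cross_count X2 X4 k \<le> 2 * u + 4 * G - 2 * t - k)"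
      using cross_count_spaced_interval[of "G - t" u "2 * G - t + 1" G k] unfolding X2_def[symmetric] X4_def[symmetric] by auto
  qed
  finally show ?thesis by (simp add: G_def)
qed

section \<open>Sidon sets modulo m and their combination with a dense set\<close>

definition modular_sidon :: "int \<Rightarrow> int set \<Rightarrow> bool" where
  "modular_sidon m S \<longleftrightarrow> S \<subseteq> {0..<m} \<and> 
    (\<forall>a\<in>S. \<forall>b\<in>S. \<forall>c\<in>S. \<forall>d\<in>S. m dvd (a + b) - (c + d) \<longrightarrow> (a = c \<and> b = d) \<or> (a = d \<and> b = c))"

text \<open>By the Chinese remainder theorem \<open>x i\<close> is the residue that is i modulo p -
  1 and r^i modulo p. A sum of two fixes i + j modulo p - 1, hence the product r^i r^j modulo p, and
  also r^i + r^j modulo p; sum and product determine the unordered pair.\<close>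

lemma ruzsa_modular_sidon:
  fixes p :: nat
  assumes p: "prime p"
  obtains S where "modular_sidon (int (p * (p - 1))) S" "card S = p - 1"
proof -
  obtain r where r: "residue_primroot p r"
    using prime_primitive_root_exists[OF prime_gt_1_nat[OF p] p] by blast
  have p1: "p > 1" using p by (rule prime_gt_1_nat)
  have cop: "coprime p r" and ord: "ord p r = p - 1"
    using r p by (auto simp: residue_primroot_def totient_prime)
  define m where "m = int p * (int p - 1)"
  have m: "m > 0" "int (p * (p - 1)) = m" using p1 by (auto simp: m_def of_nat_diff)
  define x where "x = (\<lambda>i::nat. int i * int p - (int p - 1) * int r ^ i)"
  define s where "s = (\<lambda>i. x i mod m)"
  have uniq: "(i = i' \<and> j = j') \<or> (i = j' \<and> j = i')"
    if ij: "i < p - 1" "j < p - 1" "i' < p - 1" "j' < p - 1" and dvd: "m dvd (x i + x j) - (x i' + x j')" for i j i' j'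
  proof -
    have eq: "a = b" if "[int r ^ a = int r ^ b] (mod int p)" "a < p - 1" "b < p - 1" for a b
    proof -
      have "[r ^ a = r ^ b] (mod p)" using that(1) by (simp flip: cong_int_iff)
      then have "[a = b] (mod (p - 1))" using order_divides_expdiff[OF cop] ord by simp
      then show ?thesis using that(2,3) by (simp add: cong_def)
    qed
    have "int p - 1 dvd (x i + x j) - (x i' + x j')"
      using dvd by (rule dvd_trans[rotated]) (simp add: m_def)
    moreover have "(x i + x j) - (x i' + x j') = (int (i + j) - int (i' + j')) + (int p - 1) * ((int (i + j) - int (i' + j')) - (int r ^ i + int r ^ j - int r ^ i' - int r ^ j'))"
      by (simp add: x_def algebra_simps)
    ultimately have "int p - 1 dvd int (i + j) - int (i' + j')"
      by (simp only: dvd_add_left_iff[OF dvd_triv_left])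
    then have "[int (i + j) = int (i' + j')] (mod int (p - 1))"
      using p1 by (simp add: cong_iff_dvd_diff of_nat_diff)
    then have "[i + j = i' + j'] (mod (ord p r))" unfolding ord by (simp only: cong_int_iff)
    then have "[r ^ (i + j) = r ^ (i' + j')] (mod p)" using order_divides_expdiff[OF cop] by blast
    then have "[int (r ^ (i + j)) = int (r ^ (i' + j'))] (mod int p)" by (simp only: cong_int_iff)
    then have prod: "int p dvd int r ^ i * int r ^ j - int r ^ i' * int r ^ j'"
      by (simp add: cong_iff_dvd_diff power_add)
    have "int p dvd (x i + x j) - (x i' + x j')"
      using dvd by (rule dvd_trans[rotated]) (simp add: m_def)
    moreover have "(x i + x j) - (x i' + x j') = (int r ^ i + int r ^ j - int r ^ i' - int r ^ j') + int p * ((int (i + j) - int (i' + j')) - (int r ^ i + int r ^ j - int r ^ i' - int r ^ j'))"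
      by (simp add: x_def algebra_simps)
    ultimately have sum: "int p dvd int r ^ i + int r ^ j - int r ^ i' - int r ^ j'"
      by (simp only: dvd_add_left_iff[OF dvd_triv_left])
    \<comment> \<open>r^i is a root modulo p of the quadratic with roots r^i' and r^j', because sum
      and product agree.\<close>
    have "(int r ^ i - int r ^ i') * (int r ^ i - int r ^ j') = int r ^ i * (int r ^ i + int r ^ j - int r ^ i' - int r ^ j') - (int r ^ i * int r ^ j - int r ^ i' * int r ^ j')"
      by (simp add: algebra_simps)
    then have "int p dvd (int r ^ i - int r ^ i') * (int r ^ i - int r ^ j')"
      using dvd_diff[OF dvd_mult[OF sum] prod] by simp
    then have "int p dvd int r ^ i - int r ^ i' \<or> int p dvd int r ^ i - int r ^ j'"
      using p by (simp add: prime_dvd_mult_iff)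
    then show ?thesis
    proof
      assume d: "int p dvd int r ^ i - int r ^ i'"
      have "int p dvd int r ^ j - int r ^ j'"
        using dvd_diff[OF sum d] by (simp add: algebra_simps)
      with d show ?thesis using eq ij by (simp add: cong_iff_dvd_diff)
    next
      assume d: "int p dvd int r ^ i - int r ^ j'"
      have "int p dvd int r ^ j - int r ^ i'"
        using dvd_diff[OF sum d] by (simp add: algebra_simps)
      with d show ?thesis using eq ij by (simp add: cong_iff_dvd_diff)
    qed
  qed
  have dvd_s: "m dvd (x i + x j) - (x i' + x j')" if "m dvd (s i + s j) - (s i' + s j')" for i j i' j'
  proof -
    have "[(s i + s j) = (s i' + s j')] (mod m)" using that by (simp add: cong_iff_dvd_diff)
    then have "[x i + x j = x i' + x j'] (mod m)" by (simp add: s_def cong_def mod_simps)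
    then show ?thesis by (simp add: cong_iff_dvd_diff)
  qed
  have inj: "inj_on s {..<p - 1}"
  proof (rule inj_onI)
    fix i j assume "i \<in> {..<p - 1}" "j \<in> {..<p - 1}" "s i = s j"
    then show "i = j" using uniq[of i i j j] dvd_s[of i i j j] by auto
  qed
  have "modular_sidon m (s ` {..<p - 1})"
    unfolding modular_sidon_def
  proof (intro conjI ballI impI)
    show "s ` {..<p - 1} \<subseteq> {0..<m}" using m(1) by (auto simp: s_def)
    fix a b c d assume abcd: "a \<in> s ` {..<p - 1}" "b \<in> s ` {..<p - 1}" "c \<in> s ` {..<p - 1}" "d \<in> s ` {..<p - 1}" and dvd: "m dvd (a + b) - (c + d)"
    obtain i j i' j' where "a = s i" "b = s j" "c = s i'" "d = s j'" "i < p - 1" "j < p - 1" "i' < p - 1" "j' < p - 1"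
      using abcd by auto
    then show "(a = c \<and> b = d) \<or> (a = d \<and> b = c)" using uniq[of i j i' j'] dvd_s[of i j i' j'] dvd by auto
  qed
  moreover have "card (s ` {..<p - 1}) = p - 1" using inj by (simp add: card_image)
  ultimately show ?thesis using that m(2) by simp
qed

text \<open>The residue modulo m comes from S and the quotient from A; the shift by 1 moves the set
  into the range that starts at 1.\<close>

definition interleave :: "int \<Rightarrow> int set \<Rightarrow> int set \<Rightarrow> int set" where
  "interleave m S A = (\<lambda>(s, a). s + m * a + 1) ` (S \<times> A)"

lemma interleave_inj:
  fixes S A :: "int set"
  assumes S: "S \<subseteq> {0..<m}"
  shows "inj_on (\<lambda>(s, a). s + m * a + 1) (S \<times> A)"
proof (rule inj_onI, clarify)
  fix s a s' a' :: int assume "s \<in> S" "s' \<in> S" and eq: "s + m * a + 1 = s' + m * a' + 1"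
  then have b: "0 \<le> s" "s < m" "0 \<le> s'" "s' < m" using S by auto
  have "(s + m * a) mod m = (s' + m * a') mod m" using eq by simp
  then have "s = s'" using b by simp
  then show "s = s' \<and> a = a'" using eq b by simp
qed

lemma interleave_subset:
  assumes S: "S \<subseteq> {0..<m}" and A: "A \<subseteq> {0..L}"
  shows "interleave m S A \<subseteq> {1..m * (L + 1)}"
proof
  fix x assume "x \<in> interleave m S A"
  then obtain s a where x: "s \<in> S" "a \<in> A" "x = s + m * a + 1" by (auto simp: interleave_def)
  have b: "0 \<le> s" "s < m" "0 \<le> a" "a \<le> L" using x S A by auto
  have "m * a \<le> m * L" "0 \<le> m * a" using b by (auto intro: mult_left_mono)
  moreover have "m * (L + 1) = m * L + m" by (simp add: algebra_simps)
  ultimately have "1 \<le> x" "x \<le> m * (L + 1)" using b x(3) by linarith+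
  then show "x \<in> {1..m * (L + 1)}" by simp
qed

lemma rep_count_interleave:
  assumes S: "modular_sidon m S" and A: "finite A" "\<And>k. rep_count A k \<le> g"
  shows "rep_count (interleave m S A) k \<le> 2 * g"
proof -
  define P where "P = {(t1, t2). t1 \<in> interleave m S A \<and> t2 \<in> interleave m S A \<and> t1 + t2 = k}"
  have rep: "rep_count (interleave m S A) k = card P" by (simp add: rep_count_def P_def)
  show ?thesis
  proof (cases "P = {}")
    case True
    then show ?thesis by (simp add: rep)
  next
    case False
    then obtain s1 a1 s2 a2 where e: "s1 \<in> S" "a1 \<in> A" "s2 \<in> S" "a2 \<in> A" "(s1 + m * a1 + 1) + (s2 + m * a2 + 1) = k"
      by (auto simp: P_def interleave_def)
    have m: "m > 0" using e(1) S by (auto simp: modular_sidon_def)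
    define Q where "Q = {(b1, b2). b1 \<in> A \<and> b2 \<in> A \<and> b1 + b2 = a1 + a2}"
    have "finite Q" by (rule finite_subset[of _ "A \<times> A"]) (use A in \<open>auto simp: Q_def\<close>)
    have cQ: "card Q \<le> g" using A(2)[of "a1 + a2"] by (simp add: rep_count_def Q_def)
    define f where "f = (\<lambda>s s' (b, b'). (s + m * b + 1, s' + m * b' + 1))"
    \<comment> \<open>Every representation is compared with the fixed one: its residues are s1 and
      s2 in some order, and then m > 0 forces its quotients to sum to a1 + a2. If s1 = s2, the two
      images merely coincide.\<close>
    have "P \<subseteq> f s1 s2 ` Q \<union> f s2 s1 ` Q"
    proof
      fix z assume "z \<in> P"
      then obtain u1 b1 u2 b2 where z: "z = (u1 + m * b1 + 1, u2 + m * b2 + 1)" "u1 \<in> S" "b1 \<in> A" "u2 \<in> S" "b2 \<in> A"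
        and k: "(u1 + m * b1 + 1) + (u2 + m * b2 + 1) = k"
        by (auto simp: P_def interleave_def)
      have "(u1 + u2) - (s1 + s2) = m * ((a1 + a2) - (b1 + b2))"
        using k e(5) by (simp add: algebra_simps)
      then have "m dvd (u1 + u2) - (s1 + s2)" by simp
      then have us: "(u1 = s1 \<and> u2 = s2) \<or> (u1 = s2 \<and> u2 = s1)"
        using S z e unfolding modular_sidon_def by blast
      then have "m * ((a1 + a2) - (b1 + b2)) = 0" using \<open>(u1 + u2) - (s1 + s2) = m * ((a1 + a2) - (b1 + b2))\<close> by auto
      then have "(b1, b2) \<in> Q" using m z by (auto simp: Q_def)
      then show "z \<in> f s1 s2 ` Q \<union> f s2 s1 ` Q" using us z(1) by (force simp: f_def)
    qed
    then have "card P \<le> card (f s1 s2 ` Q \<union> f s2 s1 ` Q)" using \<open>finite Q\<close> by (intro card_mono) auto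
    also have "\<dots> \<le> card (f s1 s2 ` Q) + card (f s2 s1 ` Q)" by (rule card_Un_le)
    also have "\<dots> \<le> card Q + card Q" using \<open>finite Q\<close> by (intro add_mono card_image_le)
    finally show ?thesis using cQ by (simp add: rep)
  qed
qed

section \<open>Lower bounds for R\<close>

lemma conv_norm_le:
  assumes "finite S" "\<And>k. rep_count S k \<le> g"
  shows "conv_norm S \<le> g"
  unfolding conv_norm_def using finite_range_rep_count[OF assms(1)] assms(2) by (subst Max_le_iff) auto

lemma card_le_R:
  assumes "S \<subseteq> {1..int n}" "conv_norm S \<le> g"
  shows "card S \<le> R g n"
  unfolding R_def by (rule Max_ge[OF finite_R_set]) (use assms in blast)

lemma R_mono:
  assumes "g \<le> h" shows "R g n \<le> R h n"
  unfolding R_def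
  by (rule Max_mono[OF _ R_set_nonempty finite_R_set]) (use assms in \<open>auto intro: order_trans\<close>)

lemma R_lower_bound:
  fixes p :: nat
  assumes p: "prime p" and n: "p * (p - 1) * (3 * g - g div 3 + 1) \<le> n"
  shows "(p - 1) * (g + 2 * (g div 3) + g div 6) \<le> R (2 * g) n"
proof -
  obtain S where S: "modular_sidon (int (p * (p - 1))) S" "card S = p - 1"
    using ruzsa_modular_sidon[OF p] by blast
  define m where "m = int (p * (p - 1))"
  define T where "T = interleave m S (dense_set g)"
  have Sm: "S \<subseteq> {0..<m}" using S(1) by (simp add: modular_sidon_def m_def)
  have finS: "finite S" by (rule finite_subset[OF Sm]) simp
  have "T \<subseteq> {1..m * (3 * int g - int (g div 3) + 1)}"
    unfolding T_def by (rule interleave_subset[OF Sm dense_set_subset])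
  also have "m * (3 * int g - int (g div 3) + 1) = int (p * (p - 1) * (3 * g - g div 3 + 1))"
  proof -
    have "g div 3 \<le> 3 * g" by linarith
    then have "3 * int g - int (g div 3) + 1 = int (3 * g - g div 3 + 1)" by (simp add: of_nat_diff)
    then show ?thesis by (simp only: m_def of_nat_mult)
  qed
  finally have sub: "T \<subseteq> {1..int n}" using n by (meson atLeastatMost_subset_iff of_nat_mono order_refl subset_trans)
  have "conv_norm T \<le> 2 * g"
  proof (rule conv_norm_le)
    show "finite T" using finS by (simp add: T_def interleave_def)
    show "rep_count T k \<le> 2 * g" for k
      unfolding T_def m_def by (rule rep_count_interleave[OF S(1)]) (auto simp: rep_count_dense_set)
  qed
  then have "card T \<le> R (2 * g) n" by (rule card_le_R[OF sub])
  moreover have "card T = (p - 1) * (g + 2 * (g div 3) + g div 6)"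
    unfolding T_def interleave_def using card_image[OF interleave_inj[OF Sm, of "dense_set g"]] S(2)
    by (simp add: card_cartesian_product card_dense_set)
  ultimately show ?thesis by simp
qed

section \<open>Asymptotic lower bounds\<close>

text \<open>
  HOL-Analysis has its own \<open>sigma\<close>; as \<open>Defs\<close> is imported last, the name refers to the lower limit here.
\<close>

lemma sigma_even_le_odd: "sigma (2 * g) \<le> sigma (2 * g + 1)"
  unfolding sigma_def
proof (intro Liminf_mono always_eventually allI)
  fix n
  \<comment> \<open>The denominators agree, since (2 g + 1) div 2 = g.\<close>
  have "real (R (2 * g) n) \<le> real (R (2 * g + 1) n)" using R_mono[of "2 * g" "2 * g + 1" n] by simp
  then show "ereal (real (R (2 * g) n) / sqrt (real (2 * g div 2) * real n)) \<le> ereal (real (R (2 * g + 1) n) / sqrt (real ((2 * g + 1) div 2) * real n))"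
    by (simp add: divide_right_mono)
qed

lemma ereal_le_by_factors:
  fixes B :: real
  assumes B: "B > 0" and le: "\<And>e. 0 < e \<Longrightarrow> e < 1 \<Longrightarrow> ereal ((1 - e) * B) \<le> X"
  shows "ereal B \<le> X"
proof (rule ccontr)
  assume "\<not> ereal B \<le> X"
  then have "X < ereal B" by simp
  then obtain z where z: "X < ereal z" "ereal z < ereal B" using ereal_dense2 by blast
  \<comment> \<open>z alone could be negative; y \<ge> B / 2 keeps e below 1.\<close>
  define y where "y = max z (B / 2)"
  define e where "e = 1 - y / B"
  have y: "y < B" "y > 0" "X < ereal y"
    using z B less_le_trans[OF z(1), of "ereal y"] by (auto simp: y_def)
  have "0 < e" "e < 1" "(1 - e) * B = y" using y B by (auto simp: e_def)
  then show False using le[of e] y(3) by simp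
qed

text \<open>A prime p just below x = sqrt (n / L) satisfies p (p - 1) L \<le> n and yields at least
  ((1 - e) x - 1) c elements. As x / sqrt (g n) = 1 / sqrt (g L), the quotient tends to (1 - e) B,
  and e is arbitrary.\<close>

lemma sigma_lower_bound:
  assumes g: "g \<ge> 1"
  shows "ereal (real (g + 2 * (g div 3) + g div 6) / sqrt (3 * (real g)\<^sup>2 - real g * real (g div 3) + real g)) \<le> sigma (2 * g)"
proof -
  define c where "c = g + 2 * (g div 3) + g div 6"
  define L where "L = 3 * g - g div 3 + 1"
  have div3: "g div 3 \<le> 3 * g" by linarith
  have c: "c > 0" and L: "L > 0" using g by (auto simp: c_def L_def)
  have gL: "3 * (real g)\<^sup>2 - real g * real (g div 3) + real g = real g * real L"
    using div3 by (simp add: L_def of_nat_diff power2_eq_square algebra_simps)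
  define B where "B = real c / sqrt (real g * real L)"
  have B: "B > 0" using g c L by (simp add: B_def)
  have "ereal ((1 - e) * B) \<le> sigma (2 * g)" if e: "0 < e" "e < 1" for e
  proof -
    obtain x0 where x0: "\<And>x. x \<ge> x0 \<Longrightarrow> \<exists>p::nat. prime p \<and> (1 - e) * x \<le> real p \<and> real p \<le> x"
      using prime_in_short_interval[OF e] by blast
    define h where "h = (\<lambda>n. (1 - e) * B - real c / sqrt (real g * real n))"
    have "h \<longlonglongrightarrow> (1 - e) * B - 0"
    proof -
      have "filterlim (\<lambda>n. sqrt (real g * real n)) at_top sequentially"
        using g by real_asymp
      then have "(\<lambda>n. real c / sqrt (real g * real n)) \<longlonglongrightarrow> 0"
        by (intro tendsto_divide_0[OF tendsto_const] filterlim_at_top_imp_at_infinity)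
      then show ?thesis unfolding h_def by (intro tendsto_intros)
    qed
    then have "liminf (\<lambda>n. ereal (h n)) = ereal ((1 - e) * B)"
      by (intro lim_imp_Liminf) auto
    moreover have "liminf (\<lambda>n. ereal (h n)) \<le> sigma (2 * g)"
      unfolding sigma_def
    proof (rule Liminf_mono)
      have "filterlim (\<lambda>n. sqrt (real n / real L)) at_top sequentially"
        using L by real_asymp
      then have "eventually (\<lambda>n. sqrt (real n / real L) \<ge> x0) sequentially"
        by (simp add: filterlim_at_top)
      then show "eventually (\<lambda>n. ereal (h n) \<le> ereal (real (R (2 * g) n) / sqrt (real (2 * g div 2) * real n))) sequentially"
        using eventually_gt_at_top[of 0]
      proof eventually_elim
        case (elim n)
        define x where "x = sqrt (real n / real L)"
        obtain p :: nat where p: "prime p" "(1 - e) * x \<le> real p" "real p \<le> x"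
          using x0 elim(1) unfolding x_def by blast
        have x: "x * x * real L = real n" using L elim(2) by (simp add: x_def)
        have p1: "p \<ge> 1" using p(1) prime_ge_1_nat by blast
        have "real p * real (p - 1) \<le> x * x"
          using p p1 by (intro mult_mono) auto
        then have "real p * real (p - 1) * real L \<le> real n" unfolding x[symmetric] by (intro mult_right_mono) auto
        then have "p * (p - 1) * L \<le> n" by (simp flip: of_nat_mult)
        then have "(p - 1) * c \<le> R (2 * g) n"
          using R_lower_bound[OF p(1)] by (simp add: c_def L_def)
        then have "real (p - 1) * real c \<le> real (R (2 * g) n)" by (simp flip: of_nat_mult)
        moreover have "((1 - e) * x - 1) * real c \<le> real (p - 1) * real c"
          using p(2) p1 by (intro mult_right_mono) (auto simp: of_nat_diff)
        ultimately have R: "((1 - e) * x - 1) * real c \<le> real (R (2 * g) n)" by linarith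
        have q: "x / sqrt (real g * real n) = 1 / sqrt (real g * real L)"
          using g L elim(2) by (simp add: x_def real_sqrt_divide real_sqrt_mult)
        have "((1 - e) * x - 1) * real c / sqrt (real g * real n) = h n"
        proof -
          have "(y * x - 1) * real c / Q = y * real c * (x / Q) - real c / Q" for y Q
            by (simp add: left_diff_distrib diff_divide_distrib)
          then have "((1 - e) * x - 1) * real c / sqrt (real g * real n) = (1 - e) * real c * (x / sqrt (real g * real n)) - real c / sqrt (real g * real n)" .
          then show ?thesis unfolding q h_def B_def by simp
        qed
        moreover have "((1 - e) * x - 1) * real c / sqrt (real g * real n) \<le> real (R (2 * g) n) / sqrt (real g * real n)"
          using R by (intro divide_right_mono) auto
        ultimately show ?case by simp
      qed
    qed
    ultimately show ?thesis by simp
  qed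
  then have "ereal B \<le> sigma (2 * g)" by (rule ereal_le_by_factors[OF B])
  then show ?thesis unfolding gL B_def c_def .
qed

lemma liminf_sigma: "liminf sigma \<ge> ereal (11 / sqrt 96)"
proof -
  \<comment> \<open>The floors are replaced by linear bounds: two copies of g div 3 and one of g div
    6 lose at most 1 each, and in the denominator g div 3 \<ge> g / 3 - 1 adds one more g.\<close>
  define f where "f = (\<lambda>x::real. (11 / 6 * x - 3) / sqrt (8 / 3 * x\<^sup>2 + 2 * x))"
  have fB: "f (real g) \<le> real (g + 2 * (g div 3) + g div 6) / sqrt (3 * (real g)\<^sup>2 - real g * real (g div 3) + real g)"
    if g: "g \<ge> 2" for g :: nat
  proof -
    have d3: "real g / 3 - 1 \<le> real (g div 3)" "real (g div 3) \<le> real g / 3" and d6: "real g / 6 - 1 \<le> real (g div 6)"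
      by linarith+
    have num: "11 / 6 * real g - 3 \<le> real (g + 2 * (g div 3) + g div 6)" using d3 d6 by simp
    have "real g * (real g / 3 - 1) \<le> real g * real (g div 3)" using d3 by (intro mult_left_mono) auto
    then have den: "3 * (real g)\<^sup>2 - real g * real (g div 3) + real g \<le> 8 / 3 * (real g)\<^sup>2 + 2 * real g"
      by (simp add: power2_eq_square algebra_simps)
    have "real g * real (g div 3) \<le> real g * (real g / 3)" using d3 by (intro mult_left_mono) auto
    then have "3 * (real g)\<^sup>2 - real g * real (g div 3) + real g \<ge> 8 / 3 * (real g)\<^sup>2 + real g"
      by (simp add: power2_eq_square)
    moreover have "8 / 3 * (real g)\<^sup>2 + real g > 0" using g by (intro add_nonneg_pos) auto
    ultimately have pos: "3 * (real g)\<^sup>2 - real g * real (g div 3) + real g > 0" by linarith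
    \<comment> \<open>The numerator of \<open>f\<close> is negative at 1 and nonnegative from 2
      on.\<close>
    have "real g \<ge> 2" using g by simp
    then have "11 / 6 * real g - 3 \<ge> 0" by simp
    then show ?thesis unfolding f_def
      using num den pos by (intro frac_le) auto
  qed
  have "(f \<longlongrightarrow> 11 * inverse ((8 / 3) powr (1 / 2)) / 6) at_top"
    unfolding f_def by real_asymp
  moreover have "11 * inverse ((8 / 3) powr (1 / 2)) / 6 = 11 / 6 / sqrt (8 / 3 :: real)"
  proof -
    have "(8 / 3 :: real) powr (1 / 2) = sqrt (8 / 3)" by (rule powr_half_sqrt) simp
    moreover have "11 * inverse x / 6 = 11 / 6 / x" for x :: real by (cases "x = 0") (auto simp: field_simps)
    ultimately show ?thesis by (simp only:)
  qed
  ultimately have lim: "(f \<longlongrightarrow> 11 / 6 / sqrt (8 / 3)) at_top" by (simp only:)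
  have half: "filterlim (\<lambda>h::nat. h div 2) at_top sequentially"
    by (rule filterlim_at_top_div_const_nat) simp
  have "(\<lambda>h. f (real (h div 2))) \<longlonglongrightarrow> 11 / 6 / sqrt (8 / 3)"
    by (rule filterlim_compose[OF lim]) (rule filterlim_compose[OF filterlim_real_sequentially half])
  also have "11 / 6 / sqrt (8 / 3) = 11 / sqrt (96::real)"
  proof -
    have "sqrt 96 = sqrt (6\<^sup>2 * (8 / 3))" by simp
    also have "\<dots> = 6 * sqrt (8 / 3)" by (subst real_sqrt_mult) simp
    finally show ?thesis by simp
  qed
  finally have "liminf (\<lambda>h. ereal (f (real (h div 2)))) = ereal (11 / sqrt 96)"
    by (intro lim_imp_Liminf) auto
  moreover have "liminf (\<lambda>h. ereal (f (real (h div 2)))) \<le> liminf sigma"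
  proof (rule Liminf_mono, rule eventually_mono[OF eventually_ge_at_top[of 4]])
    fix h :: nat assume h: "4 \<le> h"
    define g where "g = h div 2"
    have g: "g \<ge> 2" using h by (simp add: g_def)
    have "ereal (f (real g)) \<le> ereal (real (g + 2 * (g div 3) + g div 6) / sqrt (3 * (real g)\<^sup>2 - real g * real (g div 3) + real g))"
      using fB[OF g] by simp
    also have "\<dots> \<le> sigma (2 * g)" using g by (intro sigma_lower_bound) auto
    also have "\<dots> \<le> sigma h"
    proof (cases "even h")
      case True
      then have "2 * g = h" by (simp add: g_def)
      then show ?thesis by simp
    next
      case False
      then have "2 * g + 1 = h" by (simp add: g_def)
      then show ?thesis using sigma_even_le_odd[of g] by simp
    qed
    finally show "ereal (f (real (h div 2))) \<le> sigma h" by (simp add: g_def)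
  qed
  ultimately show ?thesis by simp
qed

theorem theorem4:
  shows "(\<forall>g::nat. g \<ge> 1 \<longrightarrow>
            sigma (2 * g + 1) \<ge> sigma (2 * g) \<and>
            sigma (2 * g) \<ge>
              ereal (real (g + 2 * (g div 3) + g div 6)
                     / sqrt (3 * (real g)\<^sup>2 - real g * real (g div 3) + real g)))
       \<and> liminf sigma \<ge> ereal (11 / sqrt 96)"
  using sigma_even_le_odd sigma_lower_bound liminf_sigma by blast

end
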